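(* Let $m<n$ and $k$ be positive integers, let $X\in\mathbb{R}^{m\times n}$ have rank $r$ and singular values $\sigma_1\ge\dots\ge\sigma_r>0=\sigma_{r+1}=\dots=\sigma_m$, and let $J(W,S)=\tfrac12\|X-WS\|_F^2$ on $\mathbb{R}^{m\times k}\times\mathbb{R}^{k\times n}$. Let $1\le q\le\min\{k,m\}$ and let $(W_c,S_c)$ be a canonical point of rank $q$ with selected singular values $\lambda_1\ge\dots\ge\lambda_q$ and parameter matrix $C_0\in\mathbb{R}^{(n-r)\times(k-q)}$. If $(W_c,S_c)$ is not maximal, let $p\in\{1,\dots,q\}$ be the least integer with $\lambda_p<\sigma_p$. If $q<k$, let $\omega_{k-q}\ge0$ be the smallest eigenvalue of $C_0^TC_0$. (a) If $q=m$, or if $q=k<m$ and $(W_c,S_c)$ is maximal, then $(W_c,S_c)$ is a global minimum of $J$. (b) If $q=k<m$ and $(W_c,S_c)$ is not maximal, then $(W_c,S_c)$ is a strict saddle with $$\lambda_{\min}(\nabla^2J(W_c,S_c))=-\frac{\sigma_p^2-\lambda_k^2}{\frac{\lambda_k^2+1}{2}+\sqrt{\sigma_p^2+\left(\frac{\lambda_k^2-1}{2}\right)^2}} .$$ (c) If $q<\min\{k,m\}$, then $(W_c,S_c)$ is a strict saddle, with $\lambda_{\min}(\nabla^2J(W_c,S_c))$ equal to $$\frac{\omega_{k-q}}{2}-\sqrt{\sigma_{q+1}^2+\Big(\frac{\omega_{k-q}}{2}\Big)^2}$$ if $(W_c,S_c)$ is maximal, and equal to $$\min\left\{\frac{\omega_{k-q}}{2}-\sqrt{\sigma_p^2+\Big(\frac{\omega_{k-q}}{2}\Big)^2},\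 \ \frac12\left(\lambda_q^2+1-\sqrt{(\lambda_q^2-1)^2+4\sigma_p^2}\right)\right\}$$ otherwise.
   Context: $\mathbb{R}^{m\times k}\times\mathbb{R}^{k\times n}$ carries the inner product $\langle (G,H),(G',H')\rangle=\mathrm{trace}(G^TG')+\mathrm{trace}(H^TH')$. With $E=WS-X$, $\nabla J(W,S)=(ES^T,W^TE)$ and the Hessian map is the self-adjoint linear map $\nabla^2J(W,S)[(G,H)]=(GSS^T+WHS^T+EH^T,\ W^TWH+W^TGS+G^TE)$; $\lambda_{\min}$ is its smallest eigenvalue. A strict saddle is a point with $\nabla J=0$ and $\lambda_{\min}(\nabla^2J)<0$. Canonical points. One full SVD of $X$ is selected (any one) and used throughout: orthonormal bases $u_1,\dots,u_m$ of $\mathbb{R}^m$ and $v_1,\dots,v_n$ of $\mathbb{R}^n$ with $Xv_i=\sigma_iu_i$, $X^Tu_i=\sigma_iv_i$ for $i\le m$ and $Xv_i=0$ for $i>m$. Choose $q$ distinct indices $i_1,\dots,i_q\in\{1,\dots,m\}$ ordered so that $\lambda_j:=\sigma_{i_j}$ satisfies $\lambda_1\ge\dots\ge\lambda_q$ (the selected singular values). Put $\bar U=[u_{i_1},\dots,u_{i_q}]$, $\bar V=[v_{i_1},\dots,v_{i_q}]$, $\Lambda=\mathrm{diag}(\lambda_1,\dots,\lambda_q)$, $V_0=[v_{r+1},\dots,v_n]$, and let $C_0\in\mathbb{R}^{(n-r)\times(k-q)}$. The canonical point of rank $q$ with these data is $$(W_c,S_c)=\left(\begin{bmatrix}\bar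 U & 0_{m\times(k-q)}\end{bmatrix},\ \begin{bmatrix}\Lambda\bar V^T\\ C_0^TV_0^T\end{bmatrix}\right)$$ (second blocks absent if $q=k$). It is maximal if $\lambda_j=\sigma_j$ for all $j=1,\dots,q$.
   Formalization: In (c), "strict saddle" is not claimed when the canonical point is maximal and q ≥ r: there σ_{q+1}=0, so the stated formula gives λ_min=0 and the point is a global minimum. Criticality and the λ_min formula are still asserted in that case. *)

theory Defs
  imports
    "Jordan_Normal_Form.Matrix"
    "Jordan_Normal_Form.Char_Poly"
    "Jordan_Normal_Form.DL_Rank"
begin

definition mat_trace :: "real mat \<Rightarrow> real" where
  "mat_trace A = (\<Sum>i<dim_row A. A $$ (i, i))"

definition frob_norm :: "real mat \<Rightarrow> real" where
  "frob_norm A = sqrt (\<Sum>i<dim_row A. \<Sum>j<dim_col A. (A $$ (i, j))\<^sup>2)"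

definition pair_inner :: "real mat \<times> real mat \<Rightarrow> real mat \<times> real mat \<Rightarrow> real" where
  "pair_inner P Q =
     mat_trace (transpose_mat (fst P) * fst Q) + mat_trace (transpose_mat (snd P) * snd Q)"

definition objJ :: "real mat \<Rightarrow> real mat \<Rightarrow> real mat \<Rightarrow> real" where
  "objJ X W S = 1 / 2 * (frob_norm (X - W * S))\<^sup>2"

text \<open>The gradient and the Hessian map of \<^term>\<open>objJ X\<close> are given in closed form; the lemmas
  \<open>objJ_has_derivative_gradJ\<close> and \<open>gradJ_has_derivative_hessJ\<close> below show that they are the
  first and second derivatives with respect to \<^term>\<open>pair_inner\<close>.\<close>

definition gradJ :: "real mat \<Rightarrow> real mat \<Rightarrow> real mat \<Rightarrow> real mat \<times> real mat" where
  "gradJ X W S =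
     (let E = W * S - X in (E * transpose_mat S, transpose_mat W * E))"

definition hessJ ::
  "real mat \<Rightarrow> real mat \<Rightarrow> real mat \<Rightarrow> real mat \<times> real mat \<Rightarrow> real mat \<times> real mat" where
  "hessJ X W S = (\<lambda>(G, H). let E = W * S - X in
     (G * S * transpose_mat S + W * H * transpose_mat S + E * transpose_mat H,
      transpose_mat W * W * H + transpose_mat W * G * S + transpose_mat G * E))"

definition hess_eigenvalue :: "real mat \<Rightarrow> real mat \<Rightarrow> real mat \<Rightarrow> real \<Rightarrow> bool" where
  "hess_eigenvalue X W S \<mu> \<longleftrightarrow>
     (\<exists>G \<in> carrier_mat (dim_row W) (dim_col W). \<exists>H \<in> carrier_mat (dim_row S) (dim_col S).
        (G, H) \<noteq> (0\<^sub>m (dim_row W) (dim_col W), 0\<^sub>m (dim_row S) (dim_col S)) \<and>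
        hessJ X W S (G, H) = (\<mu> \<cdot>\<^sub>m G, \<mu> \<cdot>\<^sub>m H))"

definition hess_lambda_min :: "real mat \<Rightarrow> real mat \<Rightarrow> real mat \<Rightarrow> real" where
  "hess_lambda_min X W S = (LEAST \<mu>. hess_eigenvalue X W S \<mu>)"

definition critical_point :: "real mat \<Rightarrow> real mat \<Rightarrow> real mat \<Rightarrow> bool" where
  "critical_point X W S \<longleftrightarrow>
     gradJ X W S = (0\<^sub>m (dim_row W) (dim_col W), 0\<^sub>m (dim_row S) (dim_col S))"

definition strict_saddle :: "real mat \<Rightarrow> real mat \<Rightarrow> real mat \<Rightarrow> bool" where
  "strict_saddle X W S \<longleftrightarrow> critical_point X W S \<and> hess_lambda_min X W S < 0"

definition global_minimum :: "real mat \<Rightarrow> real mat \<Rightarrow> real mat \<Rightarrow> bool" where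
  "global_minimum X W S \<longleftrightarrow>
     (\<forall>W' \<in> carrier_mat (dim_row W) (dim_col W). \<forall>S' \<in> carrier_mat (dim_row S) (dim_col S).
        objJ X W S \<le> objJ X W' S')"

text \<open>All sequences (\<open>\<sigma>\<close>, \<open>u\<close>, \<open>v\<close>, \<open>\<iota>\<close>, \<open>lam\<close>) are indexed from 1; matrix and vector entries
  are indexed from 0, as in the library. An orthonormal family of \<open>d\<close> vectors of dimension \<open>d\<close>
  is a basis.\<close>

definition orthonormal_basis :: "nat \<Rightarrow> (nat \<Rightarrow> real vec) \<Rightarrow> bool" where
  "orthonormal_basis d b \<longleftrightarrow>
     (\<forall>i \<in> {1..d}. b i \<in> carrier_vec d) \<and>
     (\<forall>i \<in> {1..d}. \<forall>j \<in> {1..d}. b i \<bullet> b j = (if i = j then 1 else 0))"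

definition full_svd ::
  "nat \<Rightarrow> nat \<Rightarrow> real mat \<Rightarrow> (nat \<Rightarrow> real) \<Rightarrow> (nat \<Rightarrow> real vec) \<Rightarrow> (nat \<Rightarrow> real vec) \<Rightarrow> bool" where
  "full_svd m n X \<sigma> u v \<longleftrightarrow>
     orthonormal_basis m u \<and> orthonormal_basis n v \<and>
     (\<forall>i \<in> {1..m}. X *\<^sub>v v i = \<sigma> i \<cdot>\<^sub>v u i \<and> transpose_mat X *\<^sub>v u i = \<sigma> i \<cdot>\<^sub>v v i) \<and>
     (\<forall>i \<in> {m+1..n}. X *\<^sub>v v i = 0\<^sub>v m)"

definition index_selection ::
  "nat \<Rightarrow> nat \<Rightarrow> (nat \<Rightarrow> real) \<Rightarrow> (nat \<Rightarrow> nat) \<Rightarrow> (nat \<Rightarrow> real) \<Rightarrow> bool" where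
  "index_selection m q \<sigma> \<iota> lam \<longleftrightarrow>
     inj_on \<iota> {1..q} \<and> \<iota> ` {1..q} \<subseteq> {1..m} \<and>
     (\<forall>j \<in> {1..q}. lam j = \<sigma> (\<iota> j)) \<and>
     (\<forall>j \<in> {1..q}. \<forall>j' \<in> {1..q}. j \<le> j' \<longrightarrow> lam j' \<le> lam j)"

text \<open>\<^term>\<open>replicate (k - q) (0\<^sub>v m)\<close> and the block with \<^term>\<open>k - q\<close> rows below are empty
  if \<^term>\<open>q = k\<close>.\<close>

definition canonical_W :: "nat \<Rightarrow> nat \<Rightarrow> nat \<Rightarrow> (nat \<Rightarrow> real vec) \<Rightarrow> (nat \<Rightarrow> nat) \<Rightarrow> real mat" where
  "canonical_W m k q u \<iota> =
     mat_of_cols m (map (\<lambda>j. u (\<iota> j)) [1..<q+1] @ replicate (k - q) (0\<^sub>v m))"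

definition canonical_S ::
  "nat \<Rightarrow> nat \<Rightarrow> nat \<Rightarrow> (nat \<Rightarrow> real vec) \<Rightarrow> (nat \<Rightarrow> nat) \<Rightarrow> (nat \<Rightarrow> real) \<Rightarrow> real mat \<Rightarrow> real mat" where
  "canonical_S n r q v \<iota> lam C0 =
     (let Vbar = mat_of_cols n (map (\<lambda>j. v (\<iota> j)) [1..<q+1]);
          V0 = mat_of_cols n (map v [r+1..<n+1]);
          \<Lambda> = mat_diag q (\<lambda>a. lam (a + 1))
      in (\<Lambda> * transpose_mat Vbar) @\<^sub>r (transpose_mat C0 * transpose_mat V0))"

definition maximal_selection :: "nat \<Rightarrow> (nat \<Rightarrow> real) \<Rightarrow> (nat \<Rightarrow> real) \<Rightarrow> bool" where
  "maximal_selection q \<sigma> lam \<longleftrightarrow> (\<forall>j \<in> {1..q}. lam j = \<sigma> j)"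

definition frob_inner :: "real mat \<Rightarrow> real mat \<Rightarrow> real" where
  "frob_inner A B = mat_trace (transpose_mat A * B)"

lemma frob_inner_sum:
  assumes "A \<in> carrier_mat a b" "B \<in> carrier_mat a b"
  shows "frob_inner A B = (\<Sum>i<a. \<Sum>j<b. A $$ (i, j) * B $$ (i, j))"
proof -
  have "frob_inner A B = (\<Sum>j<b. \<Sum>i<a. A $$ (i, j) * B $$ (i, j))"
    using assms by (auto simp: frob_inner_def mat_trace_def scalar_prod_def lessThan_atLeast0
        intro!: sum.cong)
  then show ?thesis by (subst sum.swap) simp
qed

lemma frob_norm_sq:
  assumes "A \<in> carrier_mat a b"
  shows "(frob_norm A)\<^sup>2 = frob_inner A A"
  using assms by (simp add: frob_norm_def frob_inner_sum[OF assms assms] sum_nonneg power2_eq_square)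

lemma frob_inner_commute:
  assumes "A \<in> carrier_mat a b" "B \<in> carrier_mat a b"
  shows "frob_inner A B = frob_inner B A"
  by (simp add: frob_inner_sum[OF assms] frob_inner_sum[OF assms(2,1)] mult.commute)

lemma frob_inner_mult_left:
  assumes "A \<in> carrier_mat a b" "B \<in> carrier_mat b c" "C \<in> carrier_mat a c"
  shows "frob_inner (A * B) C = frob_inner B (transpose_mat A * C)"
proof -
  have "transpose_mat (A * B) * C = transpose_mat B * (transpose_mat A * C)"
    using assms by (simp add: transpose_mult[of A a b B c] assoc_mult_mat[of _ c b _ a _ c])
  then show ?thesis by (simp add: frob_inner_def)
qed

lemma frob_inner_transpose:
  assumes "A \<in> carrier_mat a b" "B \<in> carrier_mat a b"
  shows "frob_inner (transpose_mat A) (transpose_mat B) = frob_inner A B"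
proof -
  have "frob_inner (transpose_mat A) (transpose_mat B)
      = (\<Sum>i<b. \<Sum>j<a. A $$ (j, i) * B $$ (j, i))"
    using assms by (subst frob_inner_sum[of _ b a]) (auto intro!: sum.cong)
  also have "\<dots> = frob_inner A B"
    by (subst sum.swap) (simp add: frob_inner_sum[OF assms])
  finally show ?thesis .
qed

lemma frob_inner_mult_right:
  assumes "A \<in> carrier_mat a b" "B \<in> carrier_mat b c" "C \<in> carrier_mat a c"
  shows "frob_inner (A * B) C = frob_inner A (C * transpose_mat B)"
proof -
  have "frob_inner (A * B) C = frob_inner (transpose_mat (A * B)) (transpose_mat C)"
    using assms by (intro frob_inner_transpose[symmetric]) auto
  also have "\<dots> = frob_inner (transpose_mat B * transpose_mat A) (transpose_mat C)"
    using assms by (simp add: transpose_mult[of A a b B c])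
  also have "\<dots> = frob_inner (transpose_mat A) (B * transpose_mat C)"
    using assms by (subst frob_inner_mult_left[of _ c b _ a]) auto
  also have "B * transpose_mat C = transpose_mat (C * transpose_mat B)"
    using assms by (simp add: transpose_mult[of C a c _ b])
  also have "frob_inner (transpose_mat A) \<dots> = frob_inner A (C * transpose_mat B)"
    using assms by (intro frob_inner_transpose[of _ a b]) auto
  finally show ?thesis .
qed

lemma frob_inner_add_right:
  assumes "A \<in> carrier_mat a b" "B \<in> carrier_mat a b" "C \<in> carrier_mat a b"
  shows "frob_inner A (B + C) = frob_inner A B + frob_inner A C"
  using assms by (simp add: frob_inner_sum[of _ a b] sum.distrib distrib_left)

lemma frob_inner_smult_right:
  assumes "A \<in> carrier_mat a b" "B \<in> carrier_mat a b"
  shows "frob_inner A (t \<cdot>\<^sub>m B) = t * frob_inner A B"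
  using assms by (simp add: frob_inner_sum[of _ a b] sum_distrib_left mult.left_commute)

lemma residual_expand:
  fixes X W S G H :: "real mat"
  assumes "X \<in> carrier_mat m n" "W \<in> carrier_mat m k" "S \<in> carrier_mat k n"
    "G \<in> carrier_mat m k" "H \<in> carrier_mat k n"
  shows "(W + t \<cdot>\<^sub>m G) * (S + t \<cdot>\<^sub>m H) - X
    = (W * S - X) + (t \<cdot>\<^sub>m (W * H + G * S) + t\<^sup>2 \<cdot>\<^sub>m (G * H))"
proof -
  have expand: "(W + t \<cdot>\<^sub>m G) * (S + t \<cdot>\<^sub>m H) =
      (W * S + t \<cdot>\<^sub>m (G * S)) + t \<cdot>\<^sub>m (W * H + t \<cdot>\<^sub>m (G * H))"
    using assms
    by (simp add: add_mult_distrib_mat[of _ m k _ _ n] mult_add_distrib_mat[of _ m k _ n]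
        mult_smult_distrib[of _ m k _ n] mult_smult_assoc_mat[of _ m k _ n])
  have regroup: "(P + t \<cdot>\<^sub>m R) + t \<cdot>\<^sub>m (Q + t \<cdot>\<^sub>m B) - X =
      (P - X) + (t \<cdot>\<^sub>m (Q + R) + t\<^sup>2 \<cdot>\<^sub>m B)"
    if "P \<in> carrier_mat m n" "Q \<in> carrier_mat m n" "R \<in> carrier_mat m n" "B \<in> carrier_mat m n"
    for P Q R B
    by (rule eq_matI) (use that assms(1) in \<open>auto simp: power2_eq_square distrib_left\<close>)
  show ?thesis
    unfolding expand by (rule regroup) (use assms in auto)
qed

lemma objJ_alt:
  assumes "X \<in> carrier_mat m n" "W \<in> carrier_mat m k" "S \<in> carrier_mat k n"
  shows "objJ X W S = 1 / 2 * frob_inner (W * S - X) (W * S - X)"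
proof -
  have "frob_norm (X - W * S) = frob_norm (W * S - X)"
    using assms by (auto simp: frob_norm_def power2_commute intro!: arg_cong[of _ _ sqrt] sum.cong)
  then show ?thesis
    using frob_norm_sq[of "W * S - X" m n] minus_carrier_mat[OF assms(1), of "W * S"]
    by (simp add: objJ_def)
qed

lemma objJ_has_derivative_gradJ:
  assumes X: "X \<in> carrier_mat m n" and W: "W \<in> carrier_mat m k" and S: "S \<in> carrier_mat k n"
    and G: "G \<in> carrier_mat m k" and H: "H \<in> carrier_mat k n"
  shows "((\<lambda>t. objJ X (W + t \<cdot>\<^sub>m G) (S + t \<cdot>\<^sub>m H))
           has_real_derivative pair_inner (gradJ X W S) (G, H)) (at 0)"
proof -
  define E where "E = W * S - X"
  define A where "A = W * H + G * S"
  define B where "B = G * H"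
  have c: "E \<in> carrier_mat m n" "A \<in> carrier_mat m n" "B \<in> carrier_mat m n"
    using assms by (auto simp: E_def A_def B_def)
  let ?f = "frob_inner"
  have "objJ X (W + t \<cdot>\<^sub>m G) (S + t \<cdot>\<^sub>m H) =
     1 / 2 * (?f E E + 2 * t * ?f E A + t^2 * (?f A A + 2 * ?f E B) + 2 * t^3 * ?f A B
        + t^4 * ?f B B)" for t
  proof -
    let ?Y = "t \<cdot>\<^sub>m A + t\<^sup>2 \<cdot>\<^sub>m B"
    have r: "?f P (E + ?Y) = ?f P E + (t * ?f P A + t\<^sup>2 * ?f P B)"
      if "P \<in> carrier_mat m n" for P
      using that c by (simp add: frob_inner_add_right[of _ m n] frob_inner_smult_right[of _ m n])
    have cY: "E + ?Y \<in> carrier_mat m n" using c by auto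
    have "objJ X (W + t \<cdot>\<^sub>m G) (S + t \<cdot>\<^sub>m H) = 1 / 2 * ?f (E + ?Y) (E + ?Y)"
      using assms residual_expand[OF assms, of t]
      by (subst objJ_alt[of _ m n _ k]) (auto simp: E_def A_def B_def)
    also have "?f (E + ?Y) (E + ?Y) = ?f E (E + ?Y) + (t * ?f A (E + ?Y) + t\<^sup>2 * ?f B (E + ?Y))"
      using r[OF cY] frob_inner_commute[OF cY c(1)] frob_inner_commute[OF cY c(2)]
        frob_inner_commute[OF cY c(3)] by simp
    finally show ?thesis
      unfolding r[OF c(1)] r[OF c(2)] r[OF c(3)]
      unfolding frob_inner_commute[OF c(2,1)] frob_inner_commute[OF c(3,1)]
        frob_inner_commute[OF c(3,2)]
      by (simp add: algebra_simps power2_eq_square power3_eq_cube power4_eq_xxxx)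
  qed
  moreover have "pair_inner (gradJ X W S) (G, H) = ?f E A"
  proof -
    have "?f E A = ?f (W * H) E + ?f (G * S) E"
      using assms c frob_inner_commute[of E m n "W * H"] frob_inner_commute[of E m n "G * S"]
      by (simp add: A_def frob_inner_add_right[of _ m n])
    also have "\<dots> = ?f H (transpose_mat W * E) + ?f G (E * transpose_mat S)"
      using assms c frob_inner_mult_left[of W m k H n E] frob_inner_mult_right[of G m k S n E]
      by simp
    also have "\<dots> = pair_inner (gradJ X W S) (G, H)"
      using assms c frob_inner_commute[of H k n "transpose_mat W * E"]
        frob_inner_commute[of G m k "E * transpose_mat S"]
      by (simp add: pair_inner_def gradJ_def Let_def E_def[symmetric] frob_inner_def[symmetric])
    finally show ?thesis by simp
  qed
  moreover have "((\<lambda>t. 1 / 2 * (?f E E + 2 * t * ?f E A + t^2 * (?f A A + 2 * ?f E B)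
      + 2 * t^3 * ?f A B + t^4 * ?f B B)) has_real_derivative ?f E A) (at 0)"
    by (auto intro!: derivative_eq_intros)
  ultimately show ?thesis by (simp only:)
qed

lemma gradJ_has_derivative_hessJ:
  assumes X: "X \<in> carrier_mat m n" and W: "W \<in> carrier_mat m k" and S: "S \<in> carrier_mat k n"
    and G: "G \<in> carrier_mat m k" and H: "H \<in> carrier_mat k n"
    and G': "G' \<in> carrier_mat m k" and H': "H' \<in> carrier_mat k n"
  shows "((\<lambda>t. pair_inner (G', H') (gradJ X (W + t \<cdot>\<^sub>m G) (S + t \<cdot>\<^sub>m H)))
           has_real_derivative pair_inner (G', H') (hessJ X W S (G, H))) (at 0)"
proof -
  define E where "E = W * S - X"
  define A where "A = W * H + G * S"
  define B where "B = G * H"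
  have c: "E \<in> carrier_mat m n" "A \<in> carrier_mat m n" "B \<in> carrier_mat m n"
    using assms by (auto simp: E_def A_def B_def)
  let ?f = "frob_inner" and ?T = transpose_mat
  have e1: "pair_inner (G', H') (gradJ X (W + t \<cdot>\<^sub>m G) (S + t \<cdot>\<^sub>m H)) =
     (?f G' (E * ?T S) + ?f H' (?T W * E))
     + t * (?f G' (A * ?T S) + ?f G' (E * ?T H) + ?f H' (?T W * A) + ?f H' (?T G * E))
     + t^2 * (?f G' (B * ?T S) + ?f G' (A * ?T H) + ?f H' (?T W * B) + ?f H' (?T G * A))
     + t^3 * (?f G' (B * ?T H) + ?f H' (?T G * B))" for t
  proof -
    let ?Y = "E + (t \<cdot>\<^sub>m A + t\<^sup>2 \<cdot>\<^sub>m B)"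
    have cY: "?Y \<in> carrier_mat m n" using c by auto
    have tr: "?T (S + t \<cdot>\<^sub>m H) = ?T S + t \<cdot>\<^sub>m ?T H" "?T (W + t \<cdot>\<^sub>m G) = ?T W + t \<cdot>\<^sub>m ?T G"
      using assms by auto
    have 1: "?Y * ?T (S + t \<cdot>\<^sub>m H) = ?Y * ?T S + t \<cdot>\<^sub>m (?Y * ?T H)"
      using cY S H
      by (simp add: tr mult_add_distrib_mat[of _ m n _ k] mult_smult_distrib[of _ m n _ k])
    have 2: "?T (W + t \<cdot>\<^sub>m G) * ?Y = ?T W * ?Y + t \<cdot>\<^sub>m (?T G * ?Y)"
      using cY W G
      by (simp add: tr add_mult_distrib_mat[of _ k m _ _ n] mult_smult_assoc_mat[of _ k m _ n])
    have 3: "?Y * Q = E * Q + (t \<cdot>\<^sub>m (A * Q) + t\<^sup>2 \<cdot>\<^sub>m (B * Q))" if "Q \<in> carrier_mat n k" for Q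
      using that c
      by (simp add: add_mult_distrib_mat[of _ m n _ _ k] mult_smult_assoc_mat[of _ m n _ k])
    have 4: "Q * ?Y = Q * E + (t \<cdot>\<^sub>m (Q * A) + t\<^sup>2 \<cdot>\<^sub>m (Q * B))" if "Q \<in> carrier_mat k m" for Q
      using that c
      by (simp add: mult_add_distrib_mat[of _ k m _ n] mult_smult_distrib[of _ k m _ n])
    have 5: "?f G' (?Y * Q) = ?f G' (E * Q) + (t * ?f G' (A * Q) + t\<^sup>2 * ?f G' (B * Q))"
      if "Q \<in> carrier_mat n k" for Q
      using that c G'
      by (subst 3) (auto simp: frob_inner_add_right[of _ m k] frob_inner_smult_right[of _ m k])
    have 6: "?f H' (Q * ?Y) = ?f H' (Q * E) + (t * ?f H' (Q * A) + t\<^sup>2 * ?f H' (Q * B))"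
      if "Q \<in> carrier_mat k m" for Q
      using that c H'
      by (subst 4) (auto simp: frob_inner_add_right[of _ k n] frob_inner_smult_right[of _ k n])
    have 7: "?f G' (?Y * ?T (S + t \<cdot>\<^sub>m H)) = ?f G' (?Y * ?T S) + t * ?f G' (?Y * ?T H)"
      unfolding 1 using cY S H G'
      by (subst frob_inner_add_right[of _ m k]) (auto simp: frob_inner_smult_right[of _ m k])
    have 8: "?f H' (?T (W + t \<cdot>\<^sub>m G) * ?Y) = ?f H' (?T W * ?Y) + t * ?f H' (?T G * ?Y)"
      unfolding 2 using cY W G H'
      by (subst frob_inner_add_right[of _ k n]) (auto simp: frob_inner_smult_right[of _ k n])
    have "pair_inner (G', H') (gradJ X (W + t \<cdot>\<^sub>m G) (S + t \<cdot>\<^sub>m H))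
       = ?f G' (?Y * ?T (S + t \<cdot>\<^sub>m H)) + ?f H' (?T (W + t \<cdot>\<^sub>m G) * ?Y)"
      using residual_expand[OF X W S G H, of t]
      by (simp add: pair_inner_def gradJ_def Let_def frob_inner_def E_def A_def B_def)
    then show ?thesis
      unfolding 7 8
        5[OF transpose_carrier_mat[THEN iffD2, OF S]] 5[OF transpose_carrier_mat[THEN iffD2, OF H]]
        6[OF transpose_carrier_mat[THEN iffD2, OF W]] 6[OF transpose_carrier_mat[THEN iffD2, OF G]]
      by (simp add: algebra_simps power2_eq_square power3_eq_cube)
  qed
  have e2: "pair_inner (G', H') (hessJ X W S (G, H)) =
      ?f G' (A * ?T S) + ?f G' (E * ?T H) + ?f H' (?T W * A) + ?f H' (?T G * E)"
  proof -
    have h1: "A * ?T S = G * S * ?T S + W * H * ?T S"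
      using assms unfolding A_def
      by (subst add_mult_distrib_mat[of _ m n _ _ k]) (auto intro!: comm_add_mat[of _ m k])
    have h2: "?T W * A = ?T W * W * H + ?T W * G * S"
      using assms unfolding A_def
      by (subst mult_add_distrib_mat[of _ k m _ n])
        (auto simp: assoc_mult_mat[of _ k m _ k _ n])
    have "?f G' (A * ?T S + E * ?T H) = ?f G' (A * ?T S) + ?f G' (E * ?T H)"
      using assms c by (intro frob_inner_add_right[of _ m k]) auto
    moreover have "?f H' (?T W * A + ?T G * E) = ?f H' (?T W * A) + ?f H' (?T G * E)"
      using assms c by (intro frob_inner_add_right[of _ k n]) auto
    moreover have "hessJ X W S (G, H) = (A * ?T S + E * ?T H, ?T W * A + ?T G * E)"
      unfolding h1 h2 by (simp only: hessJ_def Let_def E_def split)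
    ultimately show ?thesis
      by (simp add: pair_inner_def frob_inner_def)
  qed
  show ?thesis
    unfolding e1 e2 by (auto intro!: derivative_eq_intros)
qed

end

theory Submission
  imports Defs
begin

text \<open>In the singular bases \<open>X\<close> is diagonal, the residual \<open>E = W S - X\<close> has entries \<open>- \<sigma>\<^sub>a\<close> exactly at
  the unselected diagonal positions, and the Hessian form
  \<open>\<parallel>W H + G S\<parallel>\<^sup>2 + 2 \<langle>E, G H\<rangle>\<close> is bounded below by a sum of binary forms in the pairs
  \<open>(G\<^sub>a\<^sub>j, H\<^sub>j\<^sub>a)\<close> with \<open>a\<close> unselected: \<open>\<lambda>\<^sub>j\<^sup>2 g\<^sup>2 + h\<^sup>2 - 2 \<sigma>\<^sub>a g h\<close> for \<open>j \<le> q\<close> and, by the Rayleigh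
  principle for \<open>C\<^sub>0\<^sup>T C\<^sub>0\<close>, \<open>\<omega> g\<^sup>2 - 2 \<sigma>\<^sub>a g h\<close> for \<open>j > q\<close>. Their smallest eigenvalues are the claimed
  values, which are attained at rank-one directions; the worst \<open>\<sigma>\<^sub>a\<close> is \<open>\<sigma>\<^sub>p\<close>, or \<open>\<sigma>\<^bsub>q+1\<^esub>\<close> at a maximal
  point. At maximal points with \<open>q = k\<close> global minimality is the Eckart--Young theorem, which for
  a diagonal matrix follows from Bessel's inequality in the column space of \<open>W\<close>.\<close>

subsection \<open>Orthogonal changes of bases\<close>

text \<open>The decoupling into binary forms comes from supports. Unselected rows of
  \<open>W0\<close> vanish, and so do the columns of \<open>S0\<close> at unselected
  \<open>b\<close> with \<open>s b > 0\<close>. Hence in \<open>W0 * H + G * S0\<close> an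
  unselected row sees only \<open>G\<close>, while a selected row sees only \<open>H\<close> at
  those columns. The columns of \<open>S0\<close> from \<open>r\<close> on carry \<open>C\<close>,
  but the residual vanishes in them, so nothing has to be paired there. The entries of
  \<open>G\<close> and \<open>H\<close> outside the pairs can be discarded because the claimed
  eigenvalues are nonpositive. Ties are the combinatorial obstacle: a maximal point need not select
  the leading indices, only indices with the leading values.\<close>

lemma mult_assoc_dim:
  fixes A B C :: "'a::semiring_0 mat"
  shows "dim_col A = dim_row B \<Longrightarrow> dim_col B = dim_row C \<Longrightarrow> A * B * C = A * (B * C)"
  by (rule assoc_mult_mat[of A "dim_row A" "dim_row B" B "dim_row C" C "dim_col C"]) auto

lemma transpose_mult_dim:
  fixes A B :: "'a::comm_semiring_0 mat"
  shows "dim_col A = dim_row B \<Longrightarrow>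
    transpose_mat (A * B) = transpose_mat B * transpose_mat A"
  by (rule transpose_mult[of A "dim_row A" "dim_row B" B "dim_col B"]) auto

lemma mult_add_dim:
  fixes A B C :: "'a::semiring_0 mat"
  shows "dim_col A = dim_row B \<Longrightarrow> dim_row C = dim_row B \<Longrightarrow> dim_col C = dim_col B \<Longrightarrow>
    A * (B + C) = A * B + A * C"
  by (rule mult_add_distrib_mat[of A "dim_row A" "dim_row B" B "dim_col B" C]) auto

lemma add_mult_dim:
  fixes A B C :: "'a::semiring_0 mat"
  shows "dim_col A = dim_row C \<Longrightarrow> dim_row B = dim_row A \<Longrightarrow> dim_col B = dim_col A \<Longrightarrow>
    (A + B) * C = A * C + B * C"
  by (rule add_mult_distrib_mat[of A "dim_row A" "dim_row C" B C "dim_col C"]) auto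

lemma mult_minus_dim:
  fixes A B C :: "'a::ring mat"
  shows "dim_col A = dim_row B \<Longrightarrow> dim_row C = dim_row B \<Longrightarrow> dim_col C = dim_col B \<Longrightarrow>
    A * (B - C) = A * B - A * C"
  by (rule mult_minus_distrib_mat[of A "dim_row A" "dim_row B" B "dim_col B" C]) auto

lemma minus_mult_dim:
  fixes A B C :: "'a::ring mat"
  shows "dim_col A = dim_row C \<Longrightarrow> dim_row B = dim_row A \<Longrightarrow> dim_col B = dim_col A \<Longrightarrow>
    (A - B) * C = A * C - B * C"
  by (rule minus_mult_distrib_mat[of A "dim_row A" "dim_row C" B C "dim_col C"]) auto

lemma smult_mult_dim:
  fixes A B :: "'a::comm_semiring_0 mat"
  shows "dim_col A = dim_row B \<Longrightarrow> (c \<cdot>\<^sub>m A) * B = c \<cdot>\<^sub>m (A * B)"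
    and "dim_col A = dim_row B \<Longrightarrow> A * (c \<cdot>\<^sub>m B) = c \<cdot>\<^sub>m (A * B)"
  by (rule mult_smult_assoc_mat[of A "dim_row A" "dim_row B" B "dim_col B"]
      mult_smult_distrib[of A "dim_row A" "dim_row B" B "dim_col B"]; auto)+

lemma transpose_smult_mat: "transpose_mat (c \<cdot>\<^sub>m A) = c \<cdot>\<^sub>m transpose_mat A"
  by (rule eq_matI) auto

text \<open>The side conditions are equations between dimensions, so products can be rearranged by
  rewriting without naming the sizes of their factors.\<close>

lemmas mat_dim_algebra = mult_assoc_dim transpose_mult_dim mult_add_dim add_mult_dim
  mult_minus_dim minus_mult_dim smult_mult_dim transpose_smult_mat

text \<open>Multiplying by an orthogonal matrix on the outside is invisible to \<^term>\<open>objJ\<close>,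
  \<^term>\<open>gradJ\<close> and \<^term>\<open>hessJ\<close>, so the problem can be solved for a diagonal \<open>X\<close>.\<close>

locale orthogonal_change =
  fixes m n k :: nat and U V X W S :: "real mat"
  assumes U: "U \<in> carrier_mat m m" and V: "V \<in> carrier_mat n n"
    and UU: "transpose_mat U * U = 1\<^sub>m m" and VV: "transpose_mat V * V = 1\<^sub>m n"
    and X: "X \<in> carrier_mat m n" and W: "W \<in> carrier_mat m k" and S: "S \<in> carrier_mat k n"
begin

lemma UU': "U * transpose_mat U = 1\<^sub>m m"
  using mat_mult_left_right_inverse[OF _ U UU] U by simp

lemma VV': "V * transpose_mat V = 1\<^sub>m n"
  using mat_mult_left_right_inverse[OF _ V VV] V by simp

lemma cancel:
  "dim_row A = m \<Longrightarrow> transpose_mat U * (U * A) = A"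
  "dim_row A = m \<Longrightarrow> U * (transpose_mat U * A) = A"
  "dim_row B = n \<Longrightarrow> transpose_mat V * (V * B) = B"
  "dim_row B = n \<Longrightarrow> V * (transpose_mat V * B) = B"
  using U V by (simp_all add: mult_assoc_dim[symmetric] UU UU' VV VV')

lemma residual_change:
  assumes "W' \<in> carrier_mat m k" "S' \<in> carrier_mat k n"
  shows "U * W' * (S' * transpose_mat V) - U * X * transpose_mat V
    = U * (W' * S' - X) * transpose_mat V"
  using U V X assms by (simp add: mat_dim_algebra)

lemma frob_inner_change:
  assumes "A \<in> carrier_mat m n" "B \<in> carrier_mat m n"
  shows "frob_inner (U * A * transpose_mat V) (U * B * transpose_mat V) = frob_inner A B"
proof -
  have "frob_inner (U * A * transpose_mat V) (U * B * transpose_mat V)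
      = frob_inner (A * transpose_mat V) (B * transpose_mat V)"
    using U V assms frob_inner_mult_left[of U m m "A * transpose_mat V" n "U * B * transpose_mat V"]
    by (simp add: mult_assoc_dim cancel)
  also have "\<dots> = frob_inner A B"
    using U V assms frob_inner_mult_right[of A m n "transpose_mat V" n "B * transpose_mat V"]
    by (simp add: mult_assoc_dim VV)
  finally show ?thesis .
qed

lemma objJ_change:
  assumes "W' \<in> carrier_mat m k" "S' \<in> carrier_mat k n"
  shows "objJ (U * X * transpose_mat V) (U * W') (S' * transpose_mat V) = objJ X W' S'"
proof -
  have "objJ (U * X * transpose_mat V) (U * W') (S' * transpose_mat V)
      = 1 / 2 * frob_inner (U * (W' * S' - X) * transpose_mat V) (U * (W' * S' - X) * transpose_mat V)"
    unfolding residual_change[OF assms, symmetric]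
    by (rule objJ_alt[of _ m n _ k]) (use U V X assms in auto)
  also have "\<dots> = objJ X W' S'"
    unfolding objJ_alt[OF X assms] using X assms by (subst frob_inner_change) auto
  finally show ?thesis .
qed

lemma gradJ_change:
  "gradJ (U * X * transpose_mat V) (U * W) (S * transpose_mat V)
    = (U * fst (gradJ X W S), snd (gradJ X W S) * transpose_mat V)"
proof -
  note d = carrier_matD[OF U] carrier_matD[OF V] carrier_matD[OF X] carrier_matD[OF W]
    carrier_matD[OF S]
  show ?thesis
    unfolding gradJ_def Let_def residual_change[OF W S]
    by (simp add: d mult_assoc_dim transpose_mult_dim cancel)
qed

lemma hessJ_change:
  assumes G: "G \<in> carrier_mat m k" and H: "H \<in> carrier_mat k n"
  shows "hessJ (U * X * transpose_mat V) (U * W) (S * transpose_mat V) (U * G, H * transpose_mat V)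
    = (U * fst (hessJ X W S (G, H)), snd (hessJ X W S (G, H)) * transpose_mat V)"
proof -
  note d = carrier_matD[OF U] carrier_matD[OF V] carrier_matD[OF X] carrier_matD[OF W]
    carrier_matD[OF S] carrier_matD[OF G] carrier_matD[OF H]
  show ?thesis
    unfolding hessJ_def Let_def split residual_change[OF W S] fst_conv snd_conv
    by (simp add: d mult_assoc_dim transpose_mult_dim mult_add_dim add_mult_dim cancel)
qed

lemma hess_eigenvalue_change:
  assumes "hess_eigenvalue X W S \<mu>"
  shows "hess_eigenvalue (U * X * transpose_mat V) (U * W) (S * transpose_mat V) \<mu>"
proof -
  note d = carrier_matD[OF U] carrier_matD[OF V] carrier_matD[OF X] carrier_matD[OF W]
    carrier_matD[OF S]
  obtain G H where G: "G \<in> carrier_mat m k" and H: "H \<in> carrier_mat k n"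
    and ne: "(G, H) \<noteq> (0\<^sub>m m k, 0\<^sub>m k n)"
    and e: "hessJ X W S (G, H) = (\<mu> \<cdot>\<^sub>m G, \<mu> \<cdot>\<^sub>m H)"
    using assms d unfolding hess_eigenvalue_def by auto
  have "hessJ (U * X * transpose_mat V) (U * W) (S * transpose_mat V) (U * G, H * transpose_mat V)
    = (\<mu> \<cdot>\<^sub>m (U * G), \<mu> \<cdot>\<^sub>m (H * transpose_mat V))"
    unfolding hessJ_change[OF G H] e using G H d by (simp add: smult_mult_dim)
  moreover have "(U * G, H * transpose_mat V) \<noteq> (0\<^sub>m m k, 0\<^sub>m k n)"
  proof
    assume "(U * G, H * transpose_mat V) = (0\<^sub>m m k, 0\<^sub>m k n)"
    then have a: "U * G = 0\<^sub>m m k" and b: "H * transpose_mat V = 0\<^sub>m k n" by auto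
    have "G = transpose_mat U * (U * G)" using G by (simp add: cancel)
    also have "\<dots> = 0\<^sub>m m k" unfolding a using U by simp
    finally have 1: "G = 0\<^sub>m m k" .
    have "H = H * transpose_mat V * V" using H d by (simp add: mult_assoc_dim VV)
    also have "\<dots> = 0\<^sub>m k n" unfolding b using V by simp
    finally show False using 1 ne by simp
  qed
  ultimately show ?thesis
    unfolding hess_eigenvalue_def using G H d
    by (intro bexI[where x = "U * G", OF bexI[where x = "H * transpose_mat V"]] conjI)
      (auto intro: carrier_matI)
qed

lemma hess_eigenvalue_change_iff:
  "hess_eigenvalue (U * X * transpose_mat V) (U * W) (S * transpose_mat V) \<mu>
    \<longleftrightarrow> hess_eigenvalue X W S \<mu>"
proof
  \<comment> \<open>The inverse change of bases is again an orthogonal change, with the transposes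
    of \<open>U\<close> and \<open>V\<close>, so the converse is the forward direction applied to
    it.\<close>
  interpret inv: orthogonal_change m n k "transpose_mat U" "transpose_mat V"
    "U * X * transpose_mat V" "U * W" "S * transpose_mat V"
    by unfold_locales (use U V X W S UU' VV' in auto)
  have e: "transpose_mat U * (U * X * transpose_mat V) * transpose_mat (transpose_mat V) = X"
    "transpose_mat U * (U * W) = W" "S * transpose_mat V * transpose_mat (transpose_mat V) = S"
    using U V X W S by (simp_all add: mult_assoc_dim cancel VV)
  show "hess_eigenvalue X W S \<mu>"
    if "hess_eigenvalue (U * X * transpose_mat V) (U * W) (S * transpose_mat V) \<mu>"
    using inv.hess_eigenvalue_change[OF that] unfolding e .
qed (rule hess_eigenvalue_change)

lemma hess_lambda_min_change:
  "hess_lambda_min (U * X * transpose_mat V) (U * W) (S * transpose_mat V) = hess_lambda_min X W S"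
  by (simp add: hess_lambda_min_def hess_eigenvalue_change_iff)

lemma critical_point_change:
  assumes "critical_point X W S"
  shows "critical_point (U * X * transpose_mat V) (U * W) (S * transpose_mat V)"
  using assms U V W S unfolding critical_point_def gradJ_change by simp

lemma global_minimum_change:
  assumes "global_minimum X W S"
  shows "global_minimum (U * X * transpose_mat V) (U * W) (S * transpose_mat V)"
  unfolding global_minimum_def
proof (intro ballI)
  fix W' S' :: "real mat"
  assume "W' \<in> carrier_mat (dim_row (U * W)) (dim_col (U * W))"
    "S' \<in> carrier_mat (dim_row (S * transpose_mat V)) (dim_col (S * transpose_mat V))"
  then have W': "W' \<in> carrier_mat m k" and S': "S' \<in> carrier_mat k n"
    using U V W S by auto
  \<comment> \<open>An arbitrary competitor is pulled back to the old bases; invertibility of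
    \<open>U\<close> and \<open>V\<close> makes every competitor arise this way.\<close>
  have "objJ X W S \<le> objJ X (transpose_mat U * W') (S' * V)"
    using assms W S W' S' U V unfolding global_minimum_def by auto
  also have "\<dots> = objJ (U * X * transpose_mat V) (U * (transpose_mat U * W')) (S' * V * transpose_mat V)"
    using U V W' S' by (intro objJ_change[symmetric]) auto
  also have "U * (transpose_mat U * W') = W'" using W' by (simp add: cancel)
  also have "S' * V * transpose_mat V = S'" using S' V by (simp add: mult_assoc_dim VV')
  finally show "objJ (U * X * transpose_mat V) (U * W) (S * transpose_mat V)
      \<le> objJ (U * X * transpose_mat V) W' S'"
    by (simp add: objJ_change W S)
qed

end

subsection \<open>The Hessian as a quadratic form and its rank-one eigenvectors\<close>

text \<open>Adjointness moves \<open>W\<close> and \<open>S\<close> to the other side of the inner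
  product, which completes the square. The two residual terms both turn into the pairing with
  \<open>G * H\<close>, hence the factor 2.\<close>

lemma hessJ_form:
  assumes X: "X \<in> carrier_mat m n" and W: "W \<in> carrier_mat m k" and S: "S \<in> carrier_mat k n"
    and G: "G \<in> carrier_mat m k" and H: "H \<in> carrier_mat k n"
  shows "pair_inner (G, H) (hessJ X W S (G, H))
    = frob_inner (W * H + G * S) (W * H + G * S) + 2 * frob_inner (W * S - X) (G * H)"
proof -
  define E where "E = W * S - X"
  define A where "A = W * H + G * S"
  let ?f = frob_inner and ?T = transpose_mat
  have c: "E \<in> carrier_mat m n" "A \<in> carrier_mat m n"
    using assms by (auto simp: E_def A_def)
  have "G * S * ?T S + W * H * ?T S = A * ?T S"
    unfolding A_def using assms comm_add_mat[of "G * S * ?T S" m k "W * H * ?T S"]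
    by (simp add: add_mult_dim)
  moreover have "?T W * W * H + ?T W * G * S = ?T W * A"
    unfolding A_def using assms by (simp add: mult_add_dim mult_assoc_dim)
  ultimately have "pair_inner (G, H) (hessJ X W S (G, H))
      = ?f G (A * ?T S + E * ?T H) + ?f H (?T W * A + ?T G * E)"
    by (simp only: hessJ_def Let_def E_def split pair_inner_def fst_conv snd_conv frob_inner_def)
  also have "\<dots> = ?f G (A * ?T S) + ?f G (E * ?T H) + ?f H (?T W * A) + ?f H (?T G * E)"
    using assms c frob_inner_add_right[of G m k "A * ?T S" "E * ?T H"]
      frob_inner_add_right[of H k n "?T W * A" "?T G * E"] by simp
  also have "?f G (A * ?T S) = ?f (G * S) A"
    by (rule frob_inner_mult_right[symmetric]) (use assms c in auto)
  also have "?f G (E * ?T H) = ?f (G * H) E"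
    by (rule frob_inner_mult_right[symmetric]) (use assms c in auto)
  also have "?f H (?T W * A) = ?f (W * H) A"
    by (rule frob_inner_mult_left[symmetric]) (use assms c in auto)
  also have "?f H (?T G * E) = ?f (G * H) E"
    by (rule frob_inner_mult_left[symmetric]) (use assms c in auto)
  also have "?f (G * H) E = ?f E (G * H)"
    by (rule frob_inner_commute) (use assms c in auto)
  also have "?f (G * S) A + ?f E (G * H) + ?f (W * H) A + ?f E (G * H)
      = ?f A (W * H + G * S) + 2 * ?f E (G * H)"
    using assms c frob_inner_add_right[of A m n "W * H" "G * S"]
      frob_inner_commute[of "G * S" m n A] frob_inner_commute[of "W * H" m n A] by simp
  finally show ?thesis by (simp add: A_def E_def)
qed

definition outer :: "real vec \<Rightarrow> real vec \<Rightarrow> real mat" where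
  "outer x y = mat (dim_vec x) (dim_vec y) (\<lambda>(a, b). x $ a * y $ b)"

lemma dim_outer [simp]: "dim_row (outer x y) = dim_vec x" "dim_col (outer x y) = dim_vec y"
  by (simp_all add: outer_def)

lemma outer_carrier: "x \<in> carrier_vec m \<Longrightarrow> y \<in> carrier_vec n \<Longrightarrow> outer x y \<in> carrier_mat m n"
  by (auto simp: outer_def)

lemma mult_outer: "dim_col A = dim_vec x \<Longrightarrow> A * outer x y = outer (A *\<^sub>v x) y"
  by (rule eq_matI) (auto simp: outer_def scalar_prod_def sum_distrib_left mult_ac intro!: sum.cong)

lemma outer_mult: "dim_row A = dim_vec y \<Longrightarrow> outer x y * A = outer x (transpose_mat A *\<^sub>v y)"
  by (rule eq_matI) (auto simp: outer_def scalar_prod_def sum_distrib_left mult_ac intro!: sum.cong)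

lemma transpose_outer: "transpose_mat (outer x y) = outer y x"
  by (rule eq_matI) (auto simp: outer_def)

lemma outer_smult: "outer (c \<cdot>\<^sub>v x) y = c \<cdot>\<^sub>m outer x y" "outer x (c \<cdot>\<^sub>v y) = c \<cdot>\<^sub>m outer x y"
  by (rule eq_matI; auto simp: outer_def)+

lemma outer_zero: "outer (0\<^sub>v m) y = 0\<^sub>m m (dim_vec y)" "outer x (0\<^sub>v n) = 0\<^sub>m (dim_vec x) n"
  by (rule eq_matI; auto simp: outer_def)+

lemma smult_outer_nonzero:
  assumes "x \<noteq> 0\<^sub>v m" "y \<noteq> 0\<^sub>v n" "x \<in> carrier_vec m" "y \<in> carrier_vec n" "c \<noteq> 0"
  shows "c \<cdot>\<^sub>m outer x y \<noteq> 0\<^sub>m m n"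
proof
  assume e: "c \<cdot>\<^sub>m outer x y = 0\<^sub>m m n"
  obtain a b where "a < m" "x $ a \<noteq> 0" "b < n" "y $ b \<noteq> 0"
    using assms by (auto simp: vec_eq_iff)
  then show False
    using arg_cong[OF e, of "\<lambda>A. A $$ (a, b)"] assms by (simp add: outer_def)
qed

text \<open>On the pairs \<open>(\<alpha> x z\<^sup>T, \<beta> z y\<^sup>T)\<close> the Hessian acts as the symmetric matrix with rows
  \<open>(\<rho>, -s)\<close> and \<open>(-s, \<tau>)\<close>.\<close>

lemma hess_eigenvalue_rank_one:
  assumes X: "X \<in> carrier_mat m n" and W: "W \<in> carrier_mat m k" and S: "S \<in> carrier_mat k n"
    and x: "x \<in> carrier_vec m" "x \<noteq> 0\<^sub>v m" and y: "y \<in> carrier_vec n" "y \<noteq> 0\<^sub>v n"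
    and z: "z \<in> carrier_vec k" "z \<noteq> 0\<^sub>v k"
    and Ey: "(W * S - X) *\<^sub>v y = (- s) \<cdot>\<^sub>v x" and Ex: "transpose_mat (W * S - X) *\<^sub>v x = (- s) \<cdot>\<^sub>v y"
    and Wx: "transpose_mat W *\<^sub>v x = 0\<^sub>v k" and Wz_Sy: "W *\<^sub>v z = 0\<^sub>v m \<or> S *\<^sub>v y = 0\<^sub>v k"
    and SSz: "S *\<^sub>v (transpose_mat S *\<^sub>v z) = \<rho> \<cdot>\<^sub>v z"
    and WWz: "transpose_mat W *\<^sub>v (W *\<^sub>v z) = \<tau> \<cdot>\<^sub>v z"
    and char: "(\<rho> - \<mu>) * (\<tau> - \<mu>) = s\<^sup>2"
  shows "hess_eigenvalue X W S \<mu>"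
proof -
  \<comment> \<open>A kernel vector of the 2 by 2 matrix minus \<mu>. For \<open>s = 0\<close> the
    matrix is diagonal and a unit vector works; otherwise \<open>(\<tau> - \<mu>, s)\<close> solves
    the second row identically and the first row by \<open>char\<close>.\<close>
  obtain \<alpha> \<beta> where ab: "\<alpha> \<noteq> 0 \<or> \<beta> \<noteq> 0"
    and eq1: "\<rho> * \<alpha> - s * \<beta> = \<mu> * \<alpha>" and eq2: "\<tau> * \<beta> - s * \<alpha> = \<mu> * \<beta>"
  proof (cases "s = 0")
    case True
    then show ?thesis using that[of 1 0] that[of 0 1] char by auto
  next
    case False
    then show ?thesis
      using that[of "\<tau> - \<mu>" s] char by (simp add: algebra_simps power2_eq_square)
  qed
  define E where "E = W * S - X"
  define G where "G = \<alpha> \<cdot>\<^sub>m outer x z"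
  define H where "H = \<beta> \<cdot>\<^sub>m outer z y"
  note d = carrier_matD[OF X] carrier_matD[OF W] carrier_matD[OF S]
    carrier_vecD[OF x(1)] carrier_vecD[OF y(1)] carrier_vecD[OF z(1)]
  have dE: "dim_row E = m" "dim_col E = n" by (simp_all add: E_def d)
  have G: "G \<in> carrier_mat m k" and H: "H \<in> carrier_mat k n"
    using outer_carrier x y z by (auto simp: G_def H_def)
  have 1: "G * S * transpose_mat S = (\<rho> * \<alpha>) \<cdot>\<^sub>m outer x z"
    by (rule eq_matI) (auto simp: G_def d smult_mult_dim outer_mult SSz outer_smult)
  \<comment> \<open>This mixed term is a multiple of the outer product of
    \<open>W *\<^sub>v z\<close> and \<open>S *\<^sub>v y\<close>, which explains the alternative in
    the hypotheses: the second factor vanishes for selected directions, the first for null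
    directions.\<close>
  have 2: "W * H * transpose_mat S = 0\<^sub>m m k"
  proof -
    have "W * H * transpose_mat S = \<beta> \<cdot>\<^sub>m outer (W *\<^sub>v z) (S *\<^sub>v y)"
      by (simp add: H_def d smult_mult_dim mult_outer outer_mult)
    also have "\<dots> = 0\<^sub>m m k"
      using Wz_Sy by (auto simp: outer_zero d)
    finally show ?thesis .
  qed
  have 3: "E * transpose_mat H = (- (s * \<beta>)) \<cdot>\<^sub>m outer x z"
    unfolding H_def
    by (rule eq_matI) (auto simp: transpose_smult_mat transpose_outer smult_mult_dim mult_outer d dE
        Ey[folded E_def] outer_smult)
  have 4: "transpose_mat W * W * H = (\<tau> * \<beta>) \<cdot>\<^sub>m outer z y"
  proof -
    have "transpose_mat W * W * H = transpose_mat W * (W * H)"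
      by (simp add: H_def d mult_assoc_dim)
    also have "\<dots> = \<beta> \<cdot>\<^sub>m (\<tau> \<cdot>\<^sub>m outer z y)"
      by (simp add: H_def d smult_mult_dim mult_outer WWz outer_smult)
    finally show ?thesis by (auto intro!: eq_matI)
  qed
  have 5: "transpose_mat W * G * S = 0\<^sub>m k n"
    by (simp add: G_def d smult_mult_dim mult_outer Wx outer_zero left_mult_zero_mat[OF S])
  have 6: "transpose_mat G * E = (- (s * \<alpha>)) \<cdot>\<^sub>m outer z y"
    unfolding G_def
    by (rule eq_matI) (auto simp: transpose_smult_mat transpose_outer smult_mult_dim outer_mult d dE
        Ex[folded E_def] outer_smult)
  have "hessJ X W S (G, H) = (\<mu> \<cdot>\<^sub>m G, \<mu> \<cdot>\<^sub>m H)"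
  proof -
    have "(\<rho> * \<alpha>) \<cdot>\<^sub>m outer x z + 0\<^sub>m m k + (- (s * \<beta>)) \<cdot>\<^sub>m outer x z = (\<rho> * \<alpha> - s * \<beta>) \<cdot>\<^sub>m outer x z"
      by (rule eq_matI) (auto simp: d algebra_simps)
    moreover have "(\<tau> * \<beta>) \<cdot>\<^sub>m outer z y + 0\<^sub>m k n + (- (s * \<alpha>)) \<cdot>\<^sub>m outer z y
        = (\<tau> * \<beta> - s * \<alpha>) \<cdot>\<^sub>m outer z y"
      by (rule eq_matI) (auto simp: d algebra_simps)
    moreover have "\<mu> \<cdot>\<^sub>m G = (\<mu> * \<alpha>) \<cdot>\<^sub>m outer x z" "\<mu> \<cdot>\<^sub>m H = (\<mu> * \<beta>) \<cdot>\<^sub>m outer z y"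
      by (rule eq_matI; auto simp: G_def H_def)+
    ultimately show ?thesis
      unfolding hessJ_def Let_def split E_def[symmetric] 1 2 3 4 5 6 by (simp add: eq1 eq2)
  qed
  moreover have "(G, H) \<noteq> (0\<^sub>m m k, 0\<^sub>m k n)"
    using ab smult_outer_nonzero[of x m z k \<alpha>] smult_outer_nonzero[of z k y n \<beta>] x y z
    by (auto simp: G_def H_def)
  ultimately show ?thesis
    unfolding hess_eigenvalue_def d using G H by blast
qed

subsection \<open>The smallest eigenvalue of a symmetric matrix\<close>

lemma scalar_prod_self_nonneg: "0 \<le> (z :: real vec) \<bullet> z"
  by (simp add: scalar_prod_def sum_nonneg)

lemma scalar_prod_self_pos:
  assumes "z \<in> carrier_vec d" "z \<noteq> 0\<^sub>v d"
  shows "0 < (z :: real vec) \<bullet> z"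
proof -
  obtain i where i: "i < d" "z $ i \<noteq> 0"
    using assms by (auto simp: vec_eq_iff)
  then have "0 < (\<Sum>i<d. z $ i * z $ i)"
    by (intro sum_pos2[of _ i]) (auto simp: zero_less_mult_iff linorder_neq_iff)
  then show ?thesis using assms by (simp add: scalar_prod_def lessThan_atLeast0)
qed

lemma quadratic_form_bounded:
  fixes B :: "real mat"
  assumes B: "B \<in> carrier_mat d d"
  obtains K where "0 < K" "\<And>z. z \<in> carrier_vec d \<Longrightarrow> \<bar>z \<bullet> (B *\<^sub>v z)\<bar> \<le> K * (z \<bullet> z)"
proof
  \<comment> \<open>The summand 1 makes \<open>K\<close> strictly positive, so that
    \<open>1 / K\<close> can serve as a step length later.\<close>
  define K where "K = 1 + (\<Sum>i<d. \<Sum>j<d. \<bar>B $$ (i, j)\<bar>)"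
  show "0 < K" unfolding K_def by (intro add_pos_nonneg sum_nonneg) auto
  fix z :: "real vec" assume z: "z \<in> carrier_vec d"
  have zz: "z \<bullet> z = (\<Sum>i<d. (z $ i)\<^sup>2)"
    using z by (simp add: scalar_prod_def lessThan_atLeast0 power2_eq_square)
  have le: "(z $ i)\<^sup>2 \<le> z \<bullet> z" if "i < d" for i
    unfolding zz using that by (intro member_le_sum) auto
  have "z \<bullet> (B *\<^sub>v z) = (\<Sum>i<d. \<Sum>j<d. B $$ (i, j) * (z $ i * z $ j))"
    using z B by (auto simp: scalar_prod_def lessThan_atLeast0 sum_distrib_left mult_ac
        intro!: sum.cong)
  also have "\<bar>\<dots>\<bar> \<le> (\<Sum>i<d. \<Sum>j<d. \<bar>B $$ (i, j) * (z $ i * z $ j)\<bar>)"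
    by (rule order_trans[OF sum_abs sum_mono[OF sum_abs]])
  also have "\<dots> \<le> (\<Sum>i<d. \<Sum>j<d. \<bar>B $$ (i, j)\<bar> * (z \<bullet> z))"
  proof (intro sum_mono)
    fix i j assume ij: "i \<in> {..<d}" "j \<in> {..<d}"
    have "2 * \<bar>z $ i * z $ j\<bar> \<le> (z $ i)\<^sup>2 + (z $ j)\<^sup>2"
      using sum_squares_bound[of "\<bar>z $ i\<bar>" "\<bar>z $ j\<bar>"] by (simp add: abs_mult)
    then have "\<bar>z $ i * z $ j\<bar> \<le> z \<bullet> z" using le[of i] le[of j] ij by auto
    then show "\<bar>B $$ (i, j) * (z $ i * z $ j)\<bar> \<le> \<bar>B $$ (i, j)\<bar> * (z \<bullet> z)"
      by (simp add: abs_mult mult_left_mono)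
  qed
  also have "\<dots> = (K - 1) * (z \<bullet> z)" by (simp add: K_def sum_distrib_right)
  also have "\<dots> \<le> K * (z \<bullet> z)" by (simp add: left_diff_distrib scalar_prod_self_nonneg)
  finally show "\<bar>z \<bullet> (B *\<^sub>v z)\<bar> \<le> K * (z \<bullet> z)" .
qed

text \<open>The largest \<open>c\<close> with \<open>c \<cdot> |z|\<^sup>2 \<le> z \<bullet> A z\<close> is an eigenvalue: if \<open>M = A - c I\<close> had an inverse
  \<open>B\<close>, then expanding \<open>0 \<le> (x - t B x) \<bullet> M (x - t B x)\<close> at \<open>t = 1 / K\<close>, where \<open>K\<close> bounds the form
  of \<open>B\<close>, would give \<open>x \<bullet> M x \<ge> |x|\<^sup>2 / K\<close>, contradicting the choice of \<open>c\<close>.\<close>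

lemma symmetric_min_eigenvalue:
  fixes A :: "real mat"
  assumes A: "A \<in> carrier_mat d d" and sym: "transpose_mat A = A" and d: "0 < d"
  shows "eigenvalue A (LEAST \<mu>. eigenvalue A \<mu>)"
    and "z \<in> carrier_vec d \<Longrightarrow> (LEAST \<mu>. eigenvalue A \<mu>) * (z \<bullet> z) \<le> z \<bullet> (A *\<^sub>v z)"
proof -
  define T where "T = {c. \<forall>z\<in>carrier_vec d. c * (z \<bullet> z) \<le> z \<bullet> (A *\<^sub>v z)}"
  define c where "c = Sup T"
  define M where "M = A - c \<cdot>\<^sub>m 1\<^sub>m d"
  have M: "M \<in> carrier_mat d d" unfolding M_def by (intro minus_carrier_mat) simp
  have Mz: "M *\<^sub>v z = A *\<^sub>v z - c \<cdot>\<^sub>v z" if "z \<in> carrier_vec d" for z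
  proof (rule eq_vecI)
    fix i assume "i < dim_vec (A *\<^sub>v z - c \<cdot>\<^sub>v z)"
    then have i: "i < d" using that by simp
    have "row M i = row A i - c \<cdot>\<^sub>v unit_vec d i"
      using i A by (auto simp: M_def)
    then show "(M *\<^sub>v z) $ i = (A *\<^sub>v z - c \<cdot>\<^sub>v z) $ i"
      using i A M that by (simp add: minus_scalar_prod_distrib[of _ d] row_carrier_vec)
  qed (use M A that in auto)
  have Mform: "z \<bullet> (M *\<^sub>v z) = z \<bullet> (A *\<^sub>v z) - c * (z \<bullet> z)" if z: "z \<in> carrier_vec d" for z
    unfolding Mz[OF z] using that A by (subst scalar_prod_minus_distrib[of _ d]) auto
  obtain K0 where "\<And>z. z \<in> carrier_vec d \<Longrightarrow> \<bar>z \<bullet> (A *\<^sub>v z)\<bar> \<le> K0 * (z \<bullet> z)"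
    using quadratic_form_bounded[OF A] by blast
  then have "- K0 \<in> T" unfolding T_def by (fastforce simp: abs_le_iff)
  then have ne: "T \<noteq> {}" by auto
  \<comment> \<open>A unit vector bounds \<open>T\<close> from above. This is where
    \<open>0 < d\<close> enters: in dimension 0 every real number would lie in
    \<open>T\<close>.\<close>
  define e where "e = (unit_vec d 0 :: real vec)"
  have e: "e \<in> carrier_vec d" "e \<bullet> e = 1" using d by (auto simp: e_def)
  have bdd: "bdd_above T"
    unfolding T_def using e by (intro bdd_aboveI[of _ "e \<bullet> (A *\<^sub>v e)"]) force
  have cT: "c \<in> T"
    unfolding T_def
  proof (intro CollectI ballI)
    fix z :: "real vec" assume z: "z \<in> carrier_vec d"
    show "c * (z \<bullet> z) \<le> z \<bullet> (A *\<^sub>v z)"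
    proof (cases "z = 0\<^sub>v d")
      case True
      then show ?thesis using A by simp
    next
      case False
      then have pos: "0 < z \<bullet> z" using scalar_prod_self_pos z by blast
      have "c \<le> (z \<bullet> (A *\<^sub>v z)) / (z \<bullet> z)"
        unfolding c_def using z pos by (intro cSup_least[OF ne]) (auto simp: T_def pos_le_divide_eq)
      then show ?thesis using pos by (simp add: pos_le_divide_eq)
    qed
  qed
  have "det M = 0"
  proof (rule ccontr)
    assume "det M \<noteq> 0"
    from det_non_zero_imp_unit[OF M this, of "()"] obtain B where
      B: "B \<in> carrier_mat d d" and MB: "M * B = 1\<^sub>m d"
      unfolding Units_def ring_mat_def by auto
    obtain K where K: "0 < K"
      "\<And>z. z \<in> carrier_vec d \<Longrightarrow> \<bar>z \<bullet> (B *\<^sub>v z)\<bar> \<le> K * (z \<bullet> z)"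
      using quadratic_form_bounded[OF B] by blast
    have "c + 1 / K \<in> T"
      unfolding T_def
    proof (intro CollectI ballI)
      fix x :: "real vec" assume x: "x \<in> carrier_vec d"
      define y where "y = B *\<^sub>v x"
      have y: "y \<in> carrier_vec d" using B x by (simp add: y_def)
      have My: "M *\<^sub>v y = x"
        unfolding y_def using M B x by (simp add: assoc_mult_mat_vec[symmetric] MB)
      have Msym: "transpose_mat M = M"
      proof (rule eq_matI)
        fix i j assume "i < dim_row M" "j < dim_col M"
        then have ij: "i < d" "j < d" using M by auto
        have "A $$ (j, i) = transpose_mat A $$ (i, j)"
          using ij A by (intro index_transpose_mat(1)[symmetric]) auto
        then show "transpose_mat M $$ (i, j) = M $$ (i, j)"
          using ij M A by (simp add: M_def sym)
      qed (use M in auto)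
      have yMx: "y \<bullet> (M *\<^sub>v x) = x \<bullet> x"
      proof -
        have "y \<bullet> (M *\<^sub>v x) = (M *\<^sub>v y) \<bullet> x"
          using transpose_vec_mult_scalar[OF M x y] Msym comm_scalar_prod[of "M *\<^sub>v x" d y] M x y
          by (metis mult_mat_vec_carrier)
        then show ?thesis by (simp add: My)
      qed
      \<comment> \<open>This choice minimizes \<open>- 2 * t + t\<^sup>2 * K\<close>, with minimum
        \<open>- 1 / K\<close>.\<close>
      define t where "t = 1 / K"
      define w where "w = x - t \<cdot>\<^sub>v y"
      have w: "w \<in> carrier_vec d" using x y by (simp add: w_def)
      have Mw: "M *\<^sub>v w = M *\<^sub>v x - t \<cdot>\<^sub>v x"
        unfolding w_def using M x y
        by (subst mult_minus_distrib_mat_vec[of _ d d]) (auto simp: mult_mat_vec My)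
      have "0 \<le> w \<bullet> (M *\<^sub>v w)"
        using cT w by (simp add: Mform T_def)
      also have "\<dots> = x \<bullet> (M *\<^sub>v x) - 2 * t * (x \<bullet> x) + t\<^sup>2 * (x \<bullet> y)"
      proof -
        have 1: "w \<bullet> a = x \<bullet> a - t * (y \<bullet> a)" if "a \<in> carrier_vec d" for a
          unfolding w_def using x y that by (subst minus_scalar_prod_distrib[of _ d]) auto
        have "w \<bullet> (M *\<^sub>v w) = w \<bullet> (M *\<^sub>v x) - t * (w \<bullet> x)"
          unfolding Mw using w x M by (subst scalar_prod_minus_distrib[of _ d]) auto
        also have "\<dots> = x \<bullet> (M *\<^sub>v x) - t * (x \<bullet> x) - t * (x \<bullet> x - t * (y \<bullet> x))"
          using 1[of x] 1[of "M *\<^sub>v x"] x M yMx by simp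
        also have "y \<bullet> x = x \<bullet> y" using comm_scalar_prod x y by blast
        finally show ?thesis by (simp add: algebra_simps power2_eq_square)
      qed
      also have "\<dots> \<le> x \<bullet> (M *\<^sub>v x) - 2 * t * (x \<bullet> x) + t\<^sup>2 * (K * (x \<bullet> x))"
        using K(2)[OF x] by (intro add_left_mono mult_left_mono) (auto simp: y_def)
      also have "\<dots> = x \<bullet> (M *\<^sub>v x) - 1 / K * (x \<bullet> x)"
        using K(1) by (simp add: t_def power2_eq_square field_simps)
      finally show "(c + 1 / K) * (x \<bullet> x) \<le> x \<bullet> (A *\<^sub>v x)"
        unfolding Mform[OF x] by (simp add: algebra_simps)
    qed
    then have "c + 1 / K \<le> c" unfolding c_def by (rule cSup_upper[OF _ bdd])
    then show False using K(1) by simp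
  qed
  then obtain v where v: "v \<in> carrier_vec d" "v \<noteq> 0\<^sub>v d" "M *\<^sub>v v = 0\<^sub>v d"
    using det_0_iff_vec_prod_zero[OF M] by blast
  have "A *\<^sub>v v = c \<cdot>\<^sub>v v"
  proof (rule eq_vecI)
    fix i assume i: "i < dim_vec (c \<cdot>\<^sub>v v)"
    have "(M *\<^sub>v v) $ i = (A *\<^sub>v v) $ i - (c \<cdot>\<^sub>v v) $ i"
      unfolding Mz[OF v(1)] using i v A by simp
    then show "(A *\<^sub>v v) $ i = (c \<cdot>\<^sub>v v) $ i"
      using v i by simp
  qed (use A v in auto)
  then have ev: "eigenvalue A c"
    unfolding eigenvalue_def eigenvector_def using v A by auto
  have "c \<le> \<mu>" if "eigenvalue A \<mu>" for \<mu>
  proof -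
    from that obtain z where z: "z \<in> carrier_vec d" "z \<noteq> 0\<^sub>v d" "A *\<^sub>v z = \<mu> \<cdot>\<^sub>v z"
      unfolding eigenvalue_def eigenvector_def using A by auto
    have "c * (z \<bullet> z) \<le> \<mu> * (z \<bullet> z)"
      using cT z by (auto simp: T_def)
    then show ?thesis using scalar_prod_self_pos[OF z(1,2)] by simp
  qed
  then have L: "(LEAST \<mu>. eigenvalue A \<mu>) = c"
    using ev by (intro Least_equality)
  show "eigenvalue A (LEAST \<mu>. eigenvalue A \<mu>)" unfolding L by (rule ev)
  show "(LEAST \<mu>. eigenvalue A \<mu>) * (z \<bullet> z) \<le> z \<bullet> (A *\<^sub>v z)" if "z \<in> carrier_vec d"
    unfolding L using cT that by (simp add: T_def)
qed

text \<open>Pairing \<open>z\<close> with its image under \<open>transpose_mat C * C\<close> gives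
  the squared length of \<open>C *\<^sub>v z\<close>. This squared length is the contribution of the
  parameter block to the Hessian form.\<close>

lemma gram_min_eigenvalue:
  fixes C :: "real mat"
  assumes C: "C \<in> carrier_mat a d" and d: "0 < d"
    and \<omega>: "\<omega> = (LEAST \<mu>. eigenvalue (transpose_mat C * C) \<mu>)"
  shows "eigenvalue (transpose_mat C * C) \<omega>" and "0 \<le> \<omega>"
    and "z \<in> carrier_vec d \<Longrightarrow> \<omega> * (z \<bullet> z) \<le> (C *\<^sub>v z) \<bullet> (C *\<^sub>v z)"
proof -
  have c: "transpose_mat C * C \<in> carrier_mat d d" using C by simp
  have sym: "transpose_mat (transpose_mat C * C) = transpose_mat C * C"
    using C by (simp add: transpose_mult_dim)
  have form: "z \<bullet> ((transpose_mat C * C) *\<^sub>v z) = (C *\<^sub>v z) \<bullet> (C *\<^sub>v z)"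
    if z: "z \<in> carrier_vec d" for z
  proof -
    have Cz: "C *\<^sub>v z \<in> carrier_vec a" using C z by simp
    have "(transpose_mat C * C) *\<^sub>v z = transpose_mat C *\<^sub>v (C *\<^sub>v z)"
      by (rule assoc_mult_mat_vec) (use C z in auto)
    then show ?thesis
      using transpose_vec_mult_scalar[OF C z Cz] comm_scalar_prod[of z d "transpose_mat C *\<^sub>v (C *\<^sub>v z)"]
        C z Cz by simp
  qed
  show ev: "eigenvalue (transpose_mat C * C) \<omega>"
    unfolding \<omega> by (rule symmetric_min_eigenvalue(1)[OF c sym d])
  show "z \<in> carrier_vec d \<Longrightarrow> \<omega> * (z \<bullet> z) \<le> (C *\<^sub>v z) \<bullet> (C *\<^sub>v z)"
    using symmetric_min_eigenvalue(2)[OF c sym d, of z] form[of z] unfolding \<omega> by simp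
  obtain z where z: "z \<in> carrier_vec d" "z \<noteq> 0\<^sub>v d" "(transpose_mat C * C) *\<^sub>v z = \<omega> \<cdot>\<^sub>v z"
    using ev c unfolding eigenvalue_def eigenvector_def by auto
  have "0 \<le> \<omega> * (z \<bullet> z)"
    using form[OF z(1)] z scalar_prod_self_nonneg[of "C *\<^sub>v z"] by simp
  then show "0 \<le> \<omega>" using scalar_prod_self_pos[OF z(1,2)] by (simp add: zero_le_mult_iff)
qed

subsection \<open>Approximating a diagonal matrix by a matrix of low rank\<close>

text \<open>Gram-Schmidt for vectors given by their first \<open>m\<close> coordinates. A vector
  whose residual against the earlier ones is zero adds nothing to the family, which is why
  \<open>d\<close> is only bounded by \<open>k\<close>.\<close>

lemma gram_schmidt_functions:
  fixes f :: "nat \<Rightarrow> nat \<Rightarrow> real"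
  shows "\<exists>d \<le> k. \<exists>w :: nat \<Rightarrow> nat \<Rightarrow> real.
    (\<forall>l<d. \<forall>l'<d. (\<Sum>a<m. w l a * w l' a) = (if l = l' then 1 else 0)) \<and>
    (\<forall>j<k. \<exists>c. \<forall>a<m. f j a = (\<Sum>l<d. c l * w l a))"
proof (induction k)
  case 0
  show ?case by auto
next
  case (Suc k)
  then obtain d w where d: "d \<le> k"
    and w: "\<And>l l'. l < d \<Longrightarrow> l' < d \<Longrightarrow> (\<Sum>a<m. w l a * w l' a) = (if l = l' then 1 else (0::real))"
    and span: "\<And>j. j < k \<Longrightarrow> \<exists>c. \<forall>a<m. f j a = (\<Sum>l<d. c l * w l a)"
    by blast
  define b where "b l = (\<Sum>a<m. f k a * w l a)" for l
  define g where "g a = f k a - (\<Sum>l<d. b l * w l a)" for a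
  define N where "N = sqrt (\<Sum>a<m. (g a)\<^sup>2)"
  have g_orth: "(\<Sum>a<m. g a * w l' a) = 0" if "l' < d" for l'
  proof -
    have "(\<Sum>a<m. (\<Sum>l<d. b l * w l a) * w l' a) = (\<Sum>l<d. b l * (\<Sum>a<m. w l a * w l' a))"
      unfolding sum_distrib_right sum_distrib_left by (subst sum.swap) (simp add: mult_ac)
    then have "(\<Sum>a<m. g a * w l' a) = b l' - (\<Sum>l<d. b l * (\<Sum>a<m. w l a * w l' a))"
      unfolding g_def by (simp add: left_diff_distrib sum_subtractf b_def)
    also have "(\<Sum>l<d. b l * (\<Sum>a<m. w l a * w l' a)) = (\<Sum>l<d. if l = l' then b l else 0)"
      using that by (intro sum.cong) (auto simp: w)
    finally show ?thesis using that by simp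
  qed
  show ?case
  proof (cases "N = 0")
    case True
    then have "g a = 0" if "a < m" for a
      using that unfolding N_def by (simp add: sum_nonneg_eq_0_iff)
    then have "\<forall>a<m. f k a = (\<Sum>l<d. b l * w l a)" by (simp add: g_def)
    with span have "\<exists>c. \<forall>a<m. f j a = (\<Sum>l<d. c l * w l a)" if "j < Suc k" for j
      using that less_Suc_eq by metis
    then show ?thesis using d w by (intro exI[of _ d] conjI exI[of _ w]) auto
  next
    case False
    define w' where "w' l a = (if l = d then g a / N else w l a)" for l a
    have NN: "(\<Sum>a<m. g a * g a) = N * N"
      unfolding N_def by (simp add: sum_nonneg power2_eq_square)
    have "(\<Sum>a<m. w' l a * w' l' a) = (if l = l' then 1 else 0)" if "l < Suc d" "l' < Suc d" for l l'
    proof -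
      have 1: "(\<Sum>a<m. g a / N * w l a) = 0" "(\<Sum>a<m. w l a * (g a / N)) = 0" if "l < d" for l
        using g_orth[OF that] by (simp_all add: sum_divide_distrib[symmetric] mult.commute)
      have 2: "(\<Sum>a<m. g a / N * (g a / N)) = 1"
        using NN False by (simp add: sum_divide_distrib[symmetric])
      show ?thesis
        using that 1 2 w[of l l'] by (cases "l = d"; cases "l' = d") (auto simp: w'_def)
    qed
    moreover have "\<exists>c. \<forall>a<m. f j a = (\<Sum>l<Suc d. c l * w' l a)" if "j < Suc k" for j
    proof (cases "j = k")
      case True
      have "\<forall>a<m. f k a = (\<Sum>l<Suc d. (b(d := N)) l * w' l a)"
        using False by (auto simp: w'_def g_def)
      with True show ?thesis by blast
    next
      case ne: False
      with that have "j < k" by simp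
      from span[OF this] obtain c where "\<forall>a<m. f j a = (\<Sum>l<d. c l * w l a)" by blast
      then have "\<forall>a<m. f j a = (\<Sum>l<Suc d. (c(d := 0)) l * w' l a)"
        by (auto simp: w'_def)
      then show ?thesis by blast
    qed
    ultimately show ?thesis using d by (intro exI[of _ "Suc d"] conjI exI[of _ w']) auto
  qed
qed

text \<open>Completing the square in each coefficient \<open>c l\<close>. Coefficients equal to the
  inner products give Bessel's inequality; for arbitrary coefficients, dropping the last sum bounds
  the distance to the span from below.\<close>

lemma orthonormal_residual:
  fixes w :: "nat \<Rightarrow> nat \<Rightarrow> real"
  assumes w: "\<And>l l'. l < d \<Longrightarrow> l' < d \<Longrightarrow> (\<Sum>a<m. w l a * w l' a) = (if l = l' then 1 else 0)"
  shows "(\<Sum>a<m. (x a - (\<Sum>l<d. c l * w l a))\<^sup>2)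
    = (\<Sum>a<m. (x a)\<^sup>2) - (\<Sum>l<d. (\<Sum>a<m. x a * w l a)\<^sup>2) + (\<Sum>l<d. (c l - (\<Sum>a<m. x a * w l a))\<^sup>2)"
proof -
  have 1: "(\<Sum>a<m. x a * (\<Sum>l<d. c l * w l a)) = (\<Sum>l<d. c l * (\<Sum>a<m. x a * w l a))"
    by (simp add: sum_distrib_left mult_ac) (rule sum.swap)
  have "(\<Sum>a<m. (\<Sum>l<d. c l * w l a)\<^sup>2)
      = (\<Sum>a<m. \<Sum>l<d. \<Sum>l'<d. c l * c l' * (w l a * w l' a))"
    by (simp add: power2_eq_square sum_product mult_ac)
  also have "\<dots> = (\<Sum>l<d. \<Sum>l'<d. c l * c l' * (\<Sum>a<m. w l a * w l' a))"
    by (subst sum.swap, rule sum.cong[OF refl], subst sum.swap) (simp add: sum_distrib_left)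
  also have "\<dots> = (\<Sum>l<d. \<Sum>l'<d. if l = l' then c l * c l' else 0)"
    by (intro sum.cong) (auto simp: w)
  also have "\<dots> = (\<Sum>l<d. (c l)\<^sup>2)" by (simp add: power2_eq_square)
  finally have 2: "(\<Sum>a<m. (\<Sum>l<d. c l * w l a)\<^sup>2) = (\<Sum>l<d. (c l)\<^sup>2)" .
  have "(\<Sum>a<m. (x a - (\<Sum>l<d. c l * w l a))\<^sup>2)
      = (\<Sum>a<m. (x a)\<^sup>2) - 2 * (\<Sum>a<m. x a * (\<Sum>l<d. c l * w l a)) + (\<Sum>a<m. (\<Sum>l<d. c l * w l a)\<^sup>2)"
    by (simp add: power2_diff sum.distrib sum_subtractf sum_distrib_left mult_ac)
  then show ?thesis unfolding 1 2
    by (simp add: power2_diff sum.distrib sum_subtractf sum_distrib_left mult_ac)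
qed

text \<open>Let \<open>t b\<close> be the squared length of the projection of the
  \<open>b\<close>-th unit vector onto the column space of \<open>W\<close>. Column \<open>b\<close>
  of the diagonal matrix has squared distance at least \<open>(s b)\<^sup>2 * (1 - t b)\<close> from
  that space. The weights \<open>t b\<close> lie between 0 and 1 and add up to at most
  \<open>k\<close>, so they save most when placed on the \<open>k\<close> largest values.\<close>

lemma low_rank_approximation:
  fixes s :: "nat \<Rightarrow> real" and W S :: "nat \<Rightarrow> nat \<Rightarrow> real"
  assumes "k < m" "m \<le> n"
    and mono: "\<And>a b. a \<le> b \<Longrightarrow> b < m \<Longrightarrow> s b \<le> s a" and pos: "\<And>a. a < m \<Longrightarrow> 0 \<le> s a"
  shows "(\<Sum>a\<in>{k..<m}. (s a)\<^sup>2)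
    \<le> (\<Sum>b<n. \<Sum>a<m. ((if a = b then s a else 0) - (\<Sum>j<k. W a j * S j b))\<^sup>2)"
proof -
  obtain d w where d: "d \<le> k"
    and w: "\<And>l l'. l < d \<Longrightarrow> l' < d \<Longrightarrow> (\<Sum>a<m. w l a * w l' a) = (if l = l' then 1 else (0::real))"
    and "\<And>j. j < k \<Longrightarrow> \<exists>c. \<forall>a<m. W a j = (\<Sum>l<d. c l * w l a)"
    using gram_schmidt_functions[of k m "\<lambda>j a. W a j"] by blast
  then obtain c where c: "\<And>j a. j < k \<Longrightarrow> a < m \<Longrightarrow> W a j = (\<Sum>l<d. c j l * w l a)"
    by metis
  define t where "t b = (\<Sum>l<d. (w l b)\<^sup>2)" for b
  have t0: "0 \<le> t b" for b by (simp add: t_def sum_nonneg)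
  have t1: "t b \<le> 1" if b: "b < m" for b
  proof -
    define x where "x a = (if a = b then 1 else 0 :: real)" for a
    have xw: "(\<Sum>a<m. x a * w l a) = w l b" for l
      using b by (simp add: x_def if_distrib[of "\<lambda>y. y * _"] cong: if_cong)
    have "0 \<le> (\<Sum>a<m. (x a - (\<Sum>l<d. w l b * w l a))\<^sup>2)" by (intro sum_nonneg) auto
    also have "\<dots> = (\<Sum>a<m. (x a)\<^sup>2) - t b"
      by (simp add: orthonormal_residual[OF w, where c = "\<lambda>l. w l b"] xw t_def)
    also have "(\<Sum>a<m. (x a)\<^sup>2) = 1" using b by (simp add: x_def if_distrib[of "\<lambda>y. y\<^sup>2"] cong: if_cong)
    finally show ?thesis by simp
  qed
  have "(\<Sum>b<m. t b) = (\<Sum>l<d. \<Sum>b<m. w l b * w l b)"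
    unfolding t_def power2_eq_square by (rule sum.swap)
  then have tsum: "(\<Sum>b<m. t b) \<le> real k" using w d by simp
  have col: "(s b)\<^sup>2 * (1 - t b) \<le> (\<Sum>a<m. ((if a = b then s a else 0) - (\<Sum>j<k. W a j * S j b))\<^sup>2)"
    if b: "b < m" for b
  proof -
    define x where "x a = (if a = b then s a else 0)" for a
    define e where "e l = (\<Sum>j<k. c j l * S j b)" for l
    have "(\<Sum>j<k. W a j * S j b) = (\<Sum>l<d. e l * w l a)" if "a < m" for a
      unfolding e_def sum_distrib_right using that c
      by (subst sum.swap) (simp add: sum_distrib_left mult_ac)
    then have "(\<Sum>a<m. (x a - (\<Sum>j<k. W a j * S j b))\<^sup>2) = (\<Sum>a<m. (x a - (\<Sum>l<d. e l * w l a))\<^sup>2)"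
      by simp
    moreover have "(\<Sum>a<m. (x a)\<^sup>2) - (\<Sum>l<d. (\<Sum>a<m. x a * w l a)\<^sup>2)
        \<le> (\<Sum>a<m. (x a - (\<Sum>l<d. e l * w l a))\<^sup>2)"
      using orthonormal_residual[where w = w and d = d and m = m and x = x and c = e, OF w]
      by (simp add: sum_nonneg)
    moreover have "(\<Sum>a<m. (x a)\<^sup>2) = (s b)\<^sup>2"
      using b by (simp add: x_def if_distrib[of "\<lambda>y. y\<^sup>2"] cong: if_cong)
    moreover have "(\<Sum>a<m. x a * w l a) = s b * w l b" for l
      using b by (simp add: x_def if_distrib[of "\<lambda>y. y * _"] cong: if_cong)
    ultimately show ?thesis
      by (simp add: x_def t_def power_mult_distrib sum_distrib_left[symmetric] algebra_simps)
  qed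
  have split: "sum h {..<m} = sum h {..<k} + sum h {k..<m}" for h :: "nat \<Rightarrow> real"
    using \<open>k < m\<close> by (subst sum.union_disjoint[symmetric]) (auto intro!: sum.cong)
  \<comment> \<open>The value \<open>s k\<close> is the threshold: replacing it by
    \<open>s b\<close> increases the first sum, where \<open>b < k\<close>, and decreases the
    subtracted one, where \<open>b\<close> is at least \<open>k\<close>.\<close>
  have "0 \<le> (s k)\<^sup>2 * (real k - (\<Sum>b<m. t b))" using tsum by simp
  also have "\<dots> = (\<Sum>b<k. (s k)\<^sup>2 * (1 - t b)) - (\<Sum>b\<in>{k..<m}. (s k)\<^sup>2 * t b)"
    unfolding sum_distrib_left[symmetric] split by (simp add: sum_subtractf algebra_simps)
  also have "\<dots> \<le> (\<Sum>b<k. (s b)\<^sup>2 * (1 - t b)) - (\<Sum>b\<in>{k..<m}. (s b)\<^sup>2 * t b)"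
    using \<open>k < m\<close> mono pos t0 t1
    by (intro diff_mono sum_mono mult_right_mono power_mono) auto
  finally have "(\<Sum>b\<in>{k..<m}. (s b)\<^sup>2) \<le> (\<Sum>b<m. (s b)\<^sup>2 * (1 - t b))"
    unfolding split by (simp add: right_diff_distrib sum_subtractf)
  also have "\<dots> \<le> (\<Sum>b<m. \<Sum>a<m. ((if a = b then s a else 0) - (\<Sum>j<k. W a j * S j b))\<^sup>2)"
    by (intro sum_mono col) auto
  also have "\<dots> \<le> (\<Sum>b<n. \<Sum>a<m. ((if a = b then s a else 0) - (\<Sum>j<k. W a j * S j b))\<^sup>2)"
    using \<open>m \<le> n\<close> by (intro sum_mono2) (auto intro: sum_nonneg)
  finally show ?thesis .
qed

subsection \<open>Unselected singular values\<close>

text \<open>If \<open>s a\<close> exceeded \<open>s p\<close>, the set \<open>B\<close> of indices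
  with value at least \<open>s a\<close> would lie below \<open>p\<close>. The selection preserves
  values there, so it maps the finite set \<open>B\<close> injectively into itself, hence onto
  itself, and \<open>a\<close> would be selected. This argument is insensitive to ties.\<close>

lemma unselected_le:
  fixes s :: "nat \<Rightarrow> real"
  assumes "inj_on i {..<q}" "i ` {..<q} \<subseteq> {..<m}"
    and mono: "\<And>a b. a \<le> b \<Longrightarrow> b < m \<Longrightarrow> s b \<le> s a"
    and "p < m" "p \<le> q" and eq: "\<And>j. j < p \<Longrightarrow> s (i j) = s j"
    and a: "a < m" "a \<notin> i ` {..<q}"
  shows "s a \<le> s p"
proof (rule ccontr)
  assume less: "\<not> s a \<le> s p"
  define B where "B = {b. b < m \<and> s a \<le> s b}"
  have Bp: "B \<subseteq> {..<p}"
  proof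
    fix b assume "b \<in> B"
    then have b: "b < m" "s a \<le> s b" by (auto simp: B_def)
    show "b \<in> {..<p}"
    proof (rule ccontr)
      assume "b \<notin> {..<p}"
      then have "s b \<le> s p" using mono b by simp
      with b less show False by simp
    qed
  qed
  have inj: "inj_on i B"
    using Bp \<open>p \<le> q\<close> by (intro inj_on_subset[OF assms(1)]) auto
  have "i ` B \<subseteq> B"
  proof
    fix x assume "x \<in> i ` B"
    then obtain b where b: "b \<in> B" "x = i b" by auto
    with Bp have "b < p" by auto
    then have "i b < m" using assms(2) \<open>p \<le> q\<close> by (intro subsetD[OF assms(2), unfolded lessThan_iff]) auto
    moreover have "s (i b) = s b" using eq \<open>b < p\<close> .
    ultimately have "i b < m" "s (i b) = s b" by auto
    then show "x \<in> B" using b by (simp add: B_def)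
  qed
  then have "i ` B = B"
    using inj by (intro card_subset_eq) (auto simp: B_def card_image)
  moreover have "a \<in> B" using a by (simp add: B_def)
  ultimately show False using a Bp \<open>p \<le> q\<close> by force
qed

text \<open>Pigeonhole: an index up to \<open>p\<close> has value at least \<open>s p\<close>, so it
  can only be selected by a position below \<open>p\<close>. These \<open>p\<close> positions cannot
  cover \<open>p + 1\<close> indices, and \<open>unselected_le\<close> pins the value at a missed
  one.\<close>

lemma unselected_attained:
  fixes s :: "nat \<Rightarrow> real"
  assumes "inj_on i {..<q}" "i ` {..<q} \<subseteq> {..<m}"
    and mono: "\<And>a b. a \<le> b \<Longrightarrow> b < m \<Longrightarrow> s b \<le> s a"
    and "p < m" "p \<le> q" and eq: "\<And>j. j < p \<Longrightarrow> s (i j) = s j"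
    and dec: "\<And>j. p \<le> j \<Longrightarrow> j < q \<Longrightarrow> s (i j) < s p"
  obtains a where "a < m" "a \<notin> i ` {..<q}" "s a = s p"
proof -
  have "a \<in> i ` {..<p}" if "a \<le> p" "a \<in> i ` {..<q}" for a
  proof -
    from that obtain j where j: "j < q" "a = i j" by auto
    have "s p \<le> s (i j)" using mono[of "i j" p] \<open>p < m\<close> that j by simp
    with dec[of j] j have "j < p" by force
    with j show ?thesis by auto
  qed
  moreover have "\<not> {..p} \<subseteq> i ` {..<p}"
  proof
    assume "{..p} \<subseteq> i ` {..<p}"
    then have "card {..p} \<le> card {..<p}" by (rule surj_card_le[rotated]) simp
    then show False by simp
  qed
  ultimately obtain a where a: "a \<le> p" "a \<notin> i ` {..<q}" by blast
  have "s a \<le> s p" by (rule unselected_le[where s = s, OF assms(1-6)]) (use a \<open>p < m\<close> in auto)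
  moreover have "s p \<le> s a" using mono[of a p] a \<open>p < m\<close> by simp
  ultimately show ?thesis using a \<open>p < m\<close> by (intro that[of a]) auto
qed

subsection \<open>Binary quadratic forms\<close>

text \<open>The hypotheses say that the form minus \<mu> has nonnegative diagonal and determinant.
  Multiplying by its first coefficient completes the square; if that coefficient is 0, the
  determinant condition forces \<open>s = 0\<close>.\<close>

lemma binary_form_ge:
  fixes A B s \<mu> g h :: real
  assumes "\<mu> \<le> A" "\<mu> \<le> B" "s\<^sup>2 \<le> (A - \<mu>) * (B - \<mu>)"
  shows "\<mu> * (g\<^sup>2 + h\<^sup>2) \<le> A * g\<^sup>2 + B * h\<^sup>2 - 2 * s * g * h"
proof -
  define a b where "a = A - \<mu>" and "b = B - \<mu>"
  have ab: "0 \<le> a" "0 \<le> b" "s\<^sup>2 \<le> a * b" using assms by (auto simp: a_def b_def)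
  have "0 \<le> a * g\<^sup>2 + b * h\<^sup>2 - 2 * s * g * h"
  proof (cases "a = 0")
    case True
    with ab show ?thesis by simp
  next
    case False
    have "0 \<le> (a * g - s * h)\<^sup>2 + (a * b - s\<^sup>2) * h\<^sup>2" using ab by simp
    also have "\<dots> = a * (a * g\<^sup>2 + b * h\<^sup>2 - 2 * s * g * h)"
      by (simp add: power2_eq_square algebra_simps)
    finally show ?thesis using False ab by (simp add: zero_le_mult_iff)
  qed
  then show ?thesis by (simp add: a_def b_def algebra_simps)
qed

text \<open>The smaller roots of \<open>(l\<^sup>2 - \<mu>) (1 - \<mu>) = t\<^sup>2\<close> and of \<open>(\<omega> - \<mu>) (0 - \<mu>) = t\<^sup>2\<close>.\<close>

definition selected_root :: "real \<Rightarrow> real \<Rightarrow> real" where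
  "selected_root l t = 1 / 2 * (l\<^sup>2 + 1 - sqrt ((l\<^sup>2 - 1)\<^sup>2 + 4 * t\<^sup>2))"

definition null_root :: "real \<Rightarrow> real \<Rightarrow> real" where
  "null_root \<omega> t = \<omega> / 2 - sqrt (t\<^sup>2 + (\<omega> / 2)\<^sup>2)"

lemma selected_root:
  shows "(l\<^sup>2 - selected_root l t) * (1 - selected_root l t) = t\<^sup>2"
    and "selected_root l t \<le> l\<^sup>2" and "selected_root l t \<le> 1"
proof -
  define R where "R = sqrt ((l\<^sup>2 - 1)\<^sup>2 + 4 * t\<^sup>2)"
  have RR: "R * R = (l\<^sup>2 - 1)\<^sup>2 + 4 * t\<^sup>2" by (simp add: R_def)
  have "\<bar>l\<^sup>2 - 1\<bar> \<le> R" unfolding R_def by (rule real_le_rsqrt) simp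
  then show "selected_root l t \<le> l\<^sup>2" "selected_root l t \<le> 1"
    by (simp_all add: selected_root_def R_def[symmetric])
  have "(L - 1 / 2 * (L + 1 - R)) * (1 - 1 / 2 * (L + 1 - R)) = (R * R - (L - 1)\<^sup>2) / 4" for L
    by (simp add: power2_eq_square field_simps)
  from this[of "l\<^sup>2"] show "(l\<^sup>2 - selected_root l t) * (1 - selected_root l t) = t\<^sup>2"
    by (simp add: selected_root_def R_def[symmetric] RR)
qed

text \<open>Multiplying by the conjugate surd. The quotient shows the sign of the root, and it is
  the shape in which the eigenvalue is stated for \<open>q = k\<close>.\<close>

lemma selected_root_alt:
  "selected_root l t = - ((t\<^sup>2 - l\<^sup>2) / ((l\<^sup>2 + 1) / 2 + sqrt (t\<^sup>2 + ((l\<^sup>2 - 1) / 2)\<^sup>2)))"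
proof -
  define R where "R = sqrt (t\<^sup>2 + ((l\<^sup>2 - 1) / 2)\<^sup>2)"
  have "sqrt ((l\<^sup>2 - 1)\<^sup>2 + 4 * t\<^sup>2) = sqrt (4 * (t\<^sup>2 + ((l\<^sup>2 - 1) / 2)\<^sup>2))"
    by (simp add: power_divide)
  also have "\<dots> = 2 * R" unfolding R_def real_sqrt_mult by simp
  finally have root: "selected_root l t = (l\<^sup>2 + 1) / 2 - R"
    by (simp add: selected_root_def)
  have RR: "R * R = t\<^sup>2 + ((l\<^sup>2 - 1) / 2)\<^sup>2" by (simp add: R_def)
  have "0 \<le> R" by (simp add: R_def)
  then have den: "0 < (l\<^sup>2 + 1) / 2 + R" by (intro add_pos_nonneg) (auto simp: add_nonneg_pos)
  have "((l\<^sup>2 + 1) / 2 - R) * ((l\<^sup>2 + 1) / 2 + R) = ((l\<^sup>2 + 1) / 2)\<^sup>2 - R * R"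
    by (simp add: power2_eq_square algebra_simps)
  also have "\<dots> = - (t\<^sup>2 - l\<^sup>2)" unfolding RR by (simp add: power2_eq_square field_simps)
  finally have "((l\<^sup>2 + 1) / 2 - R) * ((l\<^sup>2 + 1) / 2 + R) = - (t\<^sup>2 - l\<^sup>2)" .
  then have "(l\<^sup>2 + 1) / 2 - R = - (t\<^sup>2 - l\<^sup>2) / ((l\<^sup>2 + 1) / 2 + R)"
    by (subst nonzero_eq_divide_eq) (use den in auto)
  then show ?thesis unfolding root R_def[symmetric] minus_divide_left .
qed

lemma selected_root_neg:
  assumes "l\<^sup>2 < t\<^sup>2"
  shows "selected_root l t < 0"
proof -
  have "0 < (l\<^sup>2 + 1) / 2 + sqrt (t\<^sup>2 + ((l\<^sup>2 - 1) / 2)\<^sup>2)"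
    by (intro add_pos_nonneg) (auto simp: add_nonneg_pos)
  then show ?thesis unfolding selected_root_alt using assms by simp
qed

lemma null_root:
  assumes "0 \<le> \<omega>"
  shows "(\<omega> - null_root \<omega> t) * (0 - null_root \<omega> t) = t\<^sup>2"
    and "null_root \<omega> t \<le> 0" and "t \<noteq> 0 \<Longrightarrow> null_root \<omega> t < 0"
proof -
  define R where "R = sqrt (t\<^sup>2 + (\<omega> / 2)\<^sup>2)"
  have RR: "R * R = t\<^sup>2 + (\<omega> / 2)\<^sup>2" by (simp add: R_def)
  have "\<omega> / 2 \<le> R" unfolding R_def by (rule real_le_rsqrt) simp
  then show "null_root \<omega> t \<le> 0" by (simp add: null_root_def R_def[symmetric])
  have "\<omega> / 2 < R" if "t \<noteq> 0" unfolding R_def using that by (intro real_less_rsqrt) simp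
  then show "t \<noteq> 0 \<Longrightarrow> null_root \<omega> t < 0" by (simp add: null_root_def R_def[symmetric])
  have "(\<omega> - (\<omega> / 2 - R)) * (0 - (\<omega> / 2 - R)) = R * R - (\<omega> / 2)\<^sup>2"
    by (simp add: power2_eq_square algebra_simps)
  then show "(\<omega> - null_root \<omega> t) * (0 - null_root \<omega> t) = t\<^sup>2"
    by (simp add: null_root_def R_def[symmetric] RR)
qed

text \<open>Raising the diagonal entry and weakening the coupling keep the shifted form positive
  semidefinite. One bound, from the smallest selected and the largest unselected value, thus covers
  all pairs.\<close>

lemma selected_form_ge:
  assumes "0 \<le> l" "l \<le> l'" "0 \<le> t'" "t' \<le> t"
  shows "selected_root l t * (g\<^sup>2 + h\<^sup>2) \<le> l'\<^sup>2 * g\<^sup>2 + h\<^sup>2 - 2 * t' * g * h"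
proof -
  have ll: "l\<^sup>2 \<le> l'\<^sup>2" and tt: "t'\<^sup>2 \<le> t\<^sup>2" using assms by (auto intro: power_mono)
  note root = selected_root[of l t]
  have "t\<^sup>2 \<le> (l'\<^sup>2 - selected_root l t) * (1 - selected_root l t)"
    unfolding root(1)[symmetric] using ll root(3) by (intro mult_right_mono) auto
  then show ?thesis
    using binary_form_ge[of "selected_root l t" "l'\<^sup>2" 1 t' g h] root ll tt by simp
qed

lemma null_form_ge:
  assumes "0 \<le> \<omega>" "0 \<le> t'" "t' \<le> t"
  shows "null_root \<omega> t * (g\<^sup>2 + h\<^sup>2) \<le> \<omega> * g\<^sup>2 - 2 * t' * g * h"
proof -
  have tt: "t'\<^sup>2 \<le> t\<^sup>2" using assms by (auto intro: power_mono)
  show ?thesis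
    using binary_form_ge[of "null_root \<omega> t" \<omega> 0 t' g h] null_root[OF assms(1), of t] assms(1) tt
    by simp
qed

subsection \<open>Canonical points of a diagonal matrix\<close>

lemma sum_lessThan_add: "(\<Sum>j<q + d. f j) = (\<Sum>j<q. f j) + (\<Sum>j<d. f (q + j))"
  for f :: "nat \<Rightarrow> 'a::comm_monoid_add"
  by (induction d) (simp_all add: add.assoc)

lemma sum_lessThan_shift:
  "(\<Sum>b<n. if r \<le> b then f (b - r) else 0) = (\<Sum>b<n - r. f b)"
  for f :: "nat \<Rightarrow> 'a::comm_monoid_add"
  by (induction n) (auto simp: Suc_diff_le not_le)

lemma frob_inner_self_eq_0:
  assumes A: "A \<in> carrier_mat a b" and 0: "frob_inner A A = 0"
  shows "A = 0\<^sub>m a b"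
proof (rule eq_matI)
  fix i j assume "i < dim_row (0\<^sub>m a b :: real mat)" "j < dim_col (0\<^sub>m a b :: real mat)"
  then have ij: "i < a" "j < b" by simp_all
  have "(\<Sum>j<b. A $$ (i, j) * A $$ (i, j)) = 0"
    using 0 ij unfolding frob_inner_sum[OF A A]
    by (subst (asm) sum_nonneg_eq_0_iff) (auto intro: sum_nonneg)
  then show "A $$ (i, j) = 0\<^sub>m a b $$ (i, j)"
    using ij by (subst (asm) sum_nonneg_eq_0_iff) auto
qed (use A in auto)

text \<open>All indices now start at 0, and \<open>i j\<close> is the row in which column
  \<open>j\<close> of \<open>W0\<close> has its 1. Selected values may be 0, so a selected index may
  lie among the columns from \<open>r\<close> on, where \<open>C\<close> sits.\<close>

locale diagonal_point =
  fixes m n k q r :: nat and s :: "nat \<Rightarrow> real" and i :: "nat \<Rightarrow> nat" and C :: "real mat"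
  assumes mn: "m \<le> n" and qk: "q \<le> k"
    and inj: "inj_on i {..<q}" and sel: "i ` {..<q} \<subseteq> {..<m}"
    and mono: "\<And>a b. a \<le> b \<Longrightarrow> b < m \<Longrightarrow> s b \<le> s a"
    and pos: "\<And>a. a < m \<Longrightarrow> a < r \<Longrightarrow> 0 < s a" and zero: "\<And>a. a < m \<Longrightarrow> r \<le> a \<Longrightarrow> s a = 0"
    and C: "C \<in> carrier_mat (n - r) (k - q)"
begin

abbreviation selected :: "nat set" where "selected \<equiv> i ` {..<q}"

definition X0 :: "real mat" where
  "X0 = mat m n (\<lambda>(a, b). if a = b then s a else 0)"

definition W0 :: "real mat" where
  "W0 = mat m k (\<lambda>(a, j). if j < q \<and> a = i j then 1 else 0)"

definition S0 :: "real mat" where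
  "S0 = mat k n (\<lambda>(j, b). if j < q then (if b = i j then s (i j) else 0)
    else if r \<le> b then C $$ (b - r, j - q) else 0)"

definition E0 :: "real mat" where
  "E0 = mat m n (\<lambda>(a, b). if a = b \<and> a \<notin> selected then - s a else 0)"

lemma carrier0 [simp]:
  "X0 \<in> carrier_mat m n" "W0 \<in> carrier_mat m k" "S0 \<in> carrier_mat k n" "E0 \<in> carrier_mat m n"
  by (simp_all add: X0_def W0_def S0_def E0_def)

lemmas dim0 [simp] = carrier0[THEN carrier_matD(1)] carrier0[THEN carrier_matD(2)]

lemma i_less: "j < q \<Longrightarrow> i j < m"
  using sel by auto

lemma i_eq: "j < q \<Longrightarrow> l < q \<Longrightarrow> i j = i l \<longleftrightarrow> j = l"
  using inj by (auto simp: inj_on_def)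

lemma s_nonneg: "a < m \<Longrightarrow> 0 \<le> s a"
  using pos[of a] zero[of a] by (cases "a < r") auto

lemma s_pos_iff: "a < m \<Longrightarrow> 0 < s a \<longleftrightarrow> a < r"
  using pos[of a] zero[of a] by (cases "a < r") auto

lemma W0_selected:
  assumes "l < q" "j < k"
  shows "W0 $$ (i l, j) = (if j = l then 1 else 0)"
  using assms i_less[of l] i_eq[of l j] by (auto simp: W0_def)

lemma W0_unselected: "a < m \<Longrightarrow> a \<notin> selected \<Longrightarrow> j < k \<Longrightarrow> W0 $$ (a, j) = 0"
  by (auto simp: W0_def)

lemma S0_unselected: "b < r \<Longrightarrow> b < n \<Longrightarrow> b \<notin> selected \<Longrightarrow> j < k \<Longrightarrow> S0 $$ (j, b) = 0"
  by (auto simp: S0_def)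

text \<open>The columns of \<open>W0\<close> from \<open>q\<close> on are zero, so \<open>C\<close>
  never enters the product. Row \<open>i l\<close> of the product is row \<open>l\<close> of
  \<open>S0\<close>, which agrees with row \<open>i l\<close> of \<open>X0\<close>.\<close>

lemma residual0: "W0 * S0 - X0 = E0"
proof (rule eq_matI)
  fix a b assume "a < dim_row E0" "b < dim_col E0"
  then have a: "a < m" and b: "b < n" by simp_all
  have WS: "(W0 * S0) $$ (a, b) = (\<Sum>j<k. W0 $$ (a, j) * S0 $$ (j, b))"
    using a b by (simp add: scalar_prod_def lessThan_atLeast0)
  show "(W0 * S0 - X0) $$ (a, b) = E0 $$ (a, b)"
  proof (cases "a \<in> selected")
    case True
    then obtain l where l: "l < q" "a = i l" by auto
    have "(W0 * S0) $$ (a, b) = (\<Sum>j<k. if j = l then S0 $$ (l, b) else 0)"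
      unfolding WS using l by (intro sum.cong) (auto simp: W0_selected)
    also have "\<dots> = S0 $$ (l, b)" using l qk by simp
    finally show ?thesis using a b l qk by (auto simp: E0_def X0_def S0_def)
  next
    case False
    have "(W0 * S0) $$ (a, b) = 0"
      unfolding WS using False a by (intro sum.neutral) (auto simp: W0_unselected)
    then show ?thesis using a b False by (auto simp: E0_def X0_def)
  qed
qed simp_all

text \<open>The residual lives at unselected diagonal positions \<open>a\<close>. There the row of
  \<open>W0\<close> is zero, and the column of \<open>S0\<close> is zero unless \<open>a\<close> is
  at least \<open>r\<close>, in which case \<open>s a = 0\<close>.\<close>

lemma critical_point0: "critical_point X0 W0 S0"
proof -
  have "E0 * transpose_mat S0 = 0\<^sub>m m k"
  proof (rule eq_matI)
    fix a j assume "a < dim_row (0\<^sub>m m k :: real mat)" "j < dim_col (0\<^sub>m m k :: real mat)"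
    then have aj: "a < m" "j < k" by simp_all
    have "E0 $$ (a, b) * S0 $$ (j, b) = 0" if "b < n" for b
    proof (cases "a = b \<and> a \<notin> selected")
      case True
      then show ?thesis
        using aj that S0_unselected[of a j] zero[of a] by (cases "a < r") (auto simp: E0_def)
    qed (use aj that in \<open>auto simp: E0_def\<close>)
    then show "(E0 * transpose_mat S0) $$ (a, j) = 0\<^sub>m m k $$ (a, j)"
      using aj by (auto simp: scalar_prod_def intro!: sum.neutral)
  qed simp_all
  moreover have "transpose_mat W0 * E0 = 0\<^sub>m k n"
  proof (rule eq_matI)
    fix j b assume "j < dim_row (0\<^sub>m k n :: real mat)" "b < dim_col (0\<^sub>m k n :: real mat)"
    then have jb: "j < k" "b < n" by simp_all
    have "W0 $$ (a, j) * E0 $$ (a, b) = 0" if "a < m" for a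
      using that jb W0_unselected[of a j] by (auto simp: E0_def)
    then show "(transpose_mat W0 * E0) $$ (j, b) = 0\<^sub>m k n $$ (j, b)"
      using jb by (auto simp: scalar_prod_def intro!: sum.neutral)
  qed simp_all
  ultimately show ?thesis by (simp add: critical_point_def gradJ_def Let_def residual0)
qed

lemma objJ0: "objJ X0 W0 S0 = 1 / 2 * (\<Sum>a\<in>{..<m} - selected. (s a)\<^sup>2)"
proof -
  have "frob_inner E0 E0 = (\<Sum>a<m. \<Sum>b<n. if b = a then (if a \<in> selected then 0 else (s a)\<^sup>2) else 0)"
    by (subst frob_inner_sum[OF carrier0(4) carrier0(4)], intro sum.cong refl)
      (auto simp: E0_def power2_eq_square)
  also have "\<dots> = (\<Sum>a<m. if a \<in> selected then 0 else (s a)\<^sup>2)"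
    using mn by (intro sum.cong) auto
  also have "\<dots> = (\<Sum>a\<in>{..<m} - selected. (s a)\<^sup>2)"
    by (intro sum.mono_neutral_cong_right) auto
  finally show ?thesis by (subst objJ_alt[of _ m n _ k]) (auto simp: residual0)
qed

lemma global_minimum0_full:
  assumes "q = m"
  shows "global_minimum X0 W0 S0"
proof -
  have "selected = {..<m}"
    using sel inj assms by (intro card_subset_eq) (auto simp: card_image)
  then have "objJ X0 W0 S0 = 0" by (simp add: objJ0)
  then show ?thesis by (auto simp: global_minimum_def objJ_def)
qed

lemma global_minimum0_maximal:
  assumes "q = k" "k < m" and eq: "\<And>j. j < q \<Longrightarrow> s (i j) = s j"
  shows "global_minimum X0 W0 S0"
  unfolding global_minimum_def
proof (intro ballI)
  fix W S :: "real mat"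
  assume "W \<in> carrier_mat (dim_row W0) (dim_col W0)" "S \<in> carrier_mat (dim_row S0) (dim_col S0)"
  then have W: "W \<in> carrier_mat m k" and S: "S \<in> carrier_mat k n" by simp_all
  \<comment> \<open>The selected set may differ from the first \<open>k\<close> indices, but its
    values agree with theirs; subtracting from the full sum replaces one set by the other.\<close>
  have "(\<Sum>a\<in>{..<m} - selected. (s a)\<^sup>2) = (\<Sum>a<m. (s a)\<^sup>2) - (\<Sum>a\<in>selected. (s a)\<^sup>2)"
    using sel by (intro sum_diff) auto
  also have "(\<Sum>a\<in>selected. (s a)\<^sup>2) = (\<Sum>l<q. (s (i l))\<^sup>2)"
    by (simp add: sum.reindex[OF inj])
  also have "\<dots> = (\<Sum>a<k. (s a)\<^sup>2)"
    using \<open>q = k\<close> eq by simp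
  also have "(\<Sum>a<m. (s a)\<^sup>2) - (\<Sum>a<k. (s a)\<^sup>2) = (\<Sum>a\<in>{..<m} - {..<k}. (s a)\<^sup>2)"
    using \<open>k < m\<close> by (intro sum_diff[symmetric]) auto
  also have "{..<m} - {..<k} = {k..<m}" by auto
  also have "(\<Sum>a\<in>{k..<m}. (s a)\<^sup>2)
      \<le> (\<Sum>b<n. \<Sum>a<m. ((if a = b then s a else 0) - (\<Sum>j<k. W $$ (a, j) * S $$ (j, b)))\<^sup>2)"
    using \<open>k < m\<close> mn mono s_nonneg by (rule low_rank_approximation)
  also have "\<dots> = (\<Sum>a<m. \<Sum>b<n. ((X0 - W * S) $$ (a, b))\<^sup>2)"
    using W S by (subst sum.swap)
      (auto simp: X0_def scalar_prod_def lessThan_atLeast0 intro!: sum.cong)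
  finally show "objJ X0 W0 S0 \<le> objJ X0 W S"
    unfolding objJ0 using W S by (simp add: objJ_def frob_norm_def sum_nonneg)
qed

section \<open>Rank-one eigenvectors of the Hessian at the canonical point\<close>

lemma E0_unit_vec:
  assumes "a < m" "a \<notin> selected"
  shows "E0 *\<^sub>v unit_vec n a = (- s a) \<cdot>\<^sub>v unit_vec m a"
    and "transpose_mat E0 *\<^sub>v unit_vec m a = (- s a) \<cdot>\<^sub>v unit_vec n a"
  using assms mn by (auto intro!: eq_vecI simp: E0_def)

lemma W0_unit_vec:
  assumes "a < m" "a \<notin> selected"
  shows "transpose_mat W0 *\<^sub>v unit_vec m a = 0\<^sub>v k"
  using assms W0_unselected by (auto intro!: eq_vecI)

text \<open>The direction couples entry \<open>(a, l)\<close> of \<open>G\<close> with entry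
  \<open>(l, a)\<close> of \<open>H\<close>. Positivity of \<open>s a\<close> places
  \<open>a\<close> below \<open>r\<close>, so column \<open>a\<close> of \<open>S0\<close> vanishes
  whatever \<open>C\<close> is.\<close>

lemma hess_eigenvalue0_selected:
  assumes a: "a < m" "a \<notin> selected" "0 < s a" and l: "l < q"
    and char: "((s (i l))\<^sup>2 - \<mu>) * (1 - \<mu>) = (s a)\<^sup>2"
  shows "hess_eigenvalue X0 W0 S0 \<mu>"
proof (rule hess_eigenvalue_rank_one[where x = "unit_vec m a" and y = "unit_vec n a"
      and z = "unit_vec k l" and \<rho> = "(s (i l))\<^sup>2" and \<tau> = 1 and s = "s a"])
  have an: "a < n" and lk: "l < k" using a mn l qk by auto
  show "unit_vec m a \<noteq> 0\<^sub>v m" "unit_vec n a \<noteq> 0\<^sub>v n" "unit_vec k l \<noteq> 0\<^sub>v k"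
    using a an lk by (auto dest!: arg_cong[of "unit_vec _ _" _ "\<lambda>x. x $ _"] simp: vec_eq_iff)
  show "(W0 * S0 - X0) *\<^sub>v unit_vec n a = - s a \<cdot>\<^sub>v unit_vec m a"
    "transpose_mat (W0 * S0 - X0) *\<^sub>v unit_vec m a = - s a \<cdot>\<^sub>v unit_vec n a"
    unfolding residual0 using E0_unit_vec a by auto
  show "transpose_mat W0 *\<^sub>v unit_vec m a = 0\<^sub>v k" using W0_unit_vec a by auto
  have "S0 *\<^sub>v unit_vec n a = 0\<^sub>v k"
    using a an S0_unselected[of a] s_pos_iff[of a] by (auto intro!: eq_vecI)
  then show "W0 *\<^sub>v unit_vec k l = 0\<^sub>v m \<or> S0 *\<^sub>v unit_vec n a = 0\<^sub>v k" by simp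
  have il: "i l < m" "i l < n" using i_less[OF l] mn by auto
  have "transpose_mat S0 *\<^sub>v unit_vec k l = s (i l) \<cdot>\<^sub>v unit_vec n (i l)"
    using l lk il by (auto intro!: eq_vecI simp: S0_def)
  moreover have "S0 *\<^sub>v (s (i l) \<cdot>\<^sub>v unit_vec n (i l)) = (s (i l))\<^sup>2 \<cdot>\<^sub>v unit_vec k l"
    using l lk il i_eq[OF l] zero[of "i l"]
    by (auto intro!: eq_vecI simp: S0_def power2_eq_square)
  ultimately show "S0 *\<^sub>v (transpose_mat S0 *\<^sub>v unit_vec k l) = (s (i l))\<^sup>2 \<cdot>\<^sub>v unit_vec k l"
    by simp
  have "W0 *\<^sub>v unit_vec k l = unit_vec m (i l)"
    using l lk il by (auto intro!: eq_vecI simp: W0_def)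
  moreover have "transpose_mat W0 *\<^sub>v unit_vec m (i l) = unit_vec k l"
    using l lk il W0_selected[OF l] by (auto intro!: eq_vecI)
  ultimately show "transpose_mat W0 *\<^sub>v (W0 *\<^sub>v unit_vec k l) = 1 \<cdot>\<^sub>v unit_vec k l"
    by simp
qed (use char in auto)

text \<open>An eigenvector of \<open>transpose_mat C * C\<close>, padded with \<open>q\<close>
  zeros, is killed by \<open>W0\<close>, and \<open>S0 * transpose_mat S0\<close> acts on it as the
  Gram matrix. Since \<open>W0\<close> kills it, the mixed term vanishes without any condition on
  column \<open>a\<close> of \<open>S0\<close>, and \<open>s a = 0\<close> is allowed.\<close>

lemma hess_eigenvalue0_null:
  assumes a: "a < m" "a \<notin> selected" and ev: "eigenvalue (transpose_mat C * C) \<omega>"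
    and char: "(\<omega> - \<mu>) * (0 - \<mu>) = (s a)\<^sup>2"
  shows "hess_eigenvalue X0 W0 S0 \<mu>"
proof -
  define d where "d = k - q"
  have k: "k = q + d" using qk by (simp add: d_def)
  have lk: "j < q \<Longrightarrow> j < k" "j < d \<Longrightarrow> q + j < k" for j by (auto simp: k)
  obtain z where z: "z \<in> carrier_vec d" "z \<noteq> 0\<^sub>v d" "(transpose_mat C * C) *\<^sub>v z = \<omega> \<cdot>\<^sub>v z"
    using ev C unfolding eigenvalue_def eigenvector_def d_def by auto
  define z' where "z' = vec k (\<lambda>j. if j < q then 0 else z $ (j - q))"
  define y where "y = vec n (\<lambda>b. if r \<le> b then (C *\<^sub>v z) $ (b - r) else 0)"
  show ?thesis
  proof (rule hess_eigenvalue_rank_one[where x = "unit_vec m a" and y = "unit_vec n a"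
        and z = z' and \<rho> = \<omega> and \<tau> = 0 and s = "s a"])
    show "unit_vec m a \<noteq> 0\<^sub>v m" "unit_vec n a \<noteq> 0\<^sub>v n"
      using a mn by (auto simp: vec_eq_iff)
    obtain j where "j < d" "z $ j \<noteq> 0" using z by (auto simp: vec_eq_iff)
    then have "q + j < k" "z' $ (q + j) \<noteq> 0" by (auto simp: z'_def k)
    then show "z' \<noteq> 0\<^sub>v k" by auto
    show "(W0 * S0 - X0) *\<^sub>v unit_vec n a = - s a \<cdot>\<^sub>v unit_vec m a"
      "transpose_mat (W0 * S0 - X0) *\<^sub>v unit_vec m a = - s a \<cdot>\<^sub>v unit_vec n a"
      unfolding residual0 using E0_unit_vec a by auto
    show "transpose_mat W0 *\<^sub>v unit_vec m a = 0\<^sub>v k" using W0_unit_vec a by auto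
    have Wz: "W0 *\<^sub>v z' = 0\<^sub>v m"
      by (rule eq_vecI) (auto simp: scalar_prod_def W0_def z'_def intro!: sum.neutral)
    then show "W0 *\<^sub>v z' = 0\<^sub>v m \<or> S0 *\<^sub>v unit_vec n a = 0\<^sub>v k" by simp
    show "transpose_mat W0 *\<^sub>v (W0 *\<^sub>v z') = 0 \<cdot>\<^sub>v z'"
      unfolding Wz by (auto intro!: eq_vecI simp: z'_def)
    have "transpose_mat S0 *\<^sub>v z' = y"
    proof (rule eq_vecI)
      fix b assume "b < dim_vec y"
      then have b: "b < n" by (simp add: y_def)
      have "(transpose_mat S0 *\<^sub>v z') $ b = (\<Sum>j<q + d. S0 $$ (j, b) * z' $ j)"
        using b by (simp add: scalar_prod_def lessThan_atLeast0 z'_def flip: k)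
      also have "\<dots> = (\<Sum>j<d. S0 $$ (q + j, b) * z $ j)"
        unfolding sum_lessThan_add by (simp add: z'_def lk)
      also have "\<dots> = y $ b"
        using b z C by (auto simp: y_def S0_def lk d_def[symmetric] scalar_prod_def lessThan_atLeast0 intro!: sum.cong)
      finally show "(transpose_mat S0 *\<^sub>v z') $ b = y $ b" .
    qed (simp add: y_def)
    moreover have "S0 *\<^sub>v y = \<omega> \<cdot>\<^sub>v z'"
    proof (rule eq_vecI)
      fix j assume "j < dim_vec (\<omega> \<cdot>\<^sub>v z')"
      then have j: "j < k" by (simp add: z'_def)
      have e: "(S0 *\<^sub>v y) $ j = (\<Sum>b<n. S0 $$ (j, b) * y $ b)"
        using j by (simp add: scalar_prod_def lessThan_atLeast0 y_def)
      show "(S0 *\<^sub>v y) $ j = (\<omega> \<cdot>\<^sub>v z') $ j"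
      proof (cases "j < q")
        case True
        \<comment> \<open>The vector \<open>y\<close> is supported from \<open>r\<close> on, where
          the selected singular value is 0.\<close>
        have "S0 $$ (j, b) * y $ b = 0" if "b < n" for b
          using that True j zero[of "i j"] i_less[of j] by (auto simp: S0_def y_def)
        then show ?thesis unfolding e using True j by (auto simp: z'_def intro!: sum.neutral)
      next
        case False
        define l where "l = j - q"
        have l: "l < d" "j = q + l" using False j k by (auto simp: l_def)
        have "(\<Sum>b<n. S0 $$ (j, b) * y $ b)
            = (\<Sum>b<n. if r \<le> b then C $$ (b - r, l) * (C *\<^sub>v z) $ (b - r) else 0)"
          using l j by (intro sum.cong) (auto simp: S0_def y_def)
        also have "\<dots> = (\<Sum>b<n - r. C $$ (b, l) * (C *\<^sub>v z) $ b)"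
          by (rule sum_lessThan_shift)
        also have "\<dots> = (transpose_mat C *\<^sub>v (C *\<^sub>v z)) $ l"
          using C l by (simp add: scalar_prod_def lessThan_atLeast0 d_def)
        also have "transpose_mat C *\<^sub>v (C *\<^sub>v z) = \<omega> \<cdot>\<^sub>v z"
          unfolding z(3)[symmetric] using z C
          by (intro assoc_mult_mat_vec[symmetric]) (auto simp: d_def)
        finally show ?thesis unfolding e using l j z by (simp add: z'_def)
      qed
    qed (simp add: z'_def)
    ultimately show "S0 *\<^sub>v (transpose_mat S0 *\<^sub>v z') = \<omega> \<cdot>\<^sub>v z'" by simp
  qed (use char in \<open>auto simp: z'_def\<close>)
qed

text \<open>\<open>R\<close> collects the unselected positions with nonzero residual. The rows in
  \<open>R\<close> of the square supply the \<open>G\<close> parts of the binary forms, and the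
  selected rows restricted to columns in \<open>R\<close> supply the \<open>H\<close> parts. The
  bound \<mu> is a parameter with \<open>form1\<close> and \<open>form2\<close> as its requirements,
  so every case of the theorem uses the same estimate.\<close>

lemma hess_form0_ge:
  assumes G: "G \<in> carrier_mat m k" and H: "H \<in> carrier_mat k n" and \<mu>: "\<mu> \<le> 0"
    and form1: "\<And>a l g h. a < m \<Longrightarrow> a \<notin> selected \<Longrightarrow> 0 < s a \<Longrightarrow> l < q \<Longrightarrow>
      \<mu> * (g\<^sup>2 + h\<^sup>2) \<le> (s (i l))\<^sup>2 * g\<^sup>2 + h\<^sup>2 - 2 * s a * g * h"
    and rayleigh: "\<And>z. q < k \<Longrightarrow> z \<in> carrier_vec (k - q) \<Longrightarrow>
      \<omega> * (z \<bullet> z) \<le> (C *\<^sub>v z) \<bullet> (C *\<^sub>v z)"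
    and form2: "\<And>a g h. a < m \<Longrightarrow> a \<notin> selected \<Longrightarrow> 0 < s a \<Longrightarrow> q < k \<Longrightarrow>
      \<mu> * (g\<^sup>2 + h\<^sup>2) \<le> \<omega> * g\<^sup>2 - 2 * s a * g * h"
  shows "\<mu> * pair_inner (G, H) (G, H) \<le> pair_inner (G, H) (hessJ X0 W0 S0 (G, H))"
proof -
  define d where "d = k - q"
  have k: "k = q + d" using qk by (simp add: d_def)
  have lk: "j < q \<Longrightarrow> j < k" "j < d \<Longrightarrow> q + j < k" for j by (auto simp: k)
  define R where "R = {a. a < m \<and> a \<notin> selected \<and> 0 < s a}"
  define A where "A = W0 * H + G * S0"
  have Ac: "A \<in> carrier_mat m n" using G H by (simp add: A_def)
  define g where "g a j = G $$ (a, j)" for a j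
  define h where "h j b = H $$ (j, b)" for j b
  have A_entry: "A $$ (a, b) = (\<Sum>j<k. W0 $$ (a, j) * h j b) + (\<Sum>j<k. g a j * S0 $$ (j, b))"
    if "a < m" "b < n" for a b
    using that G H by (simp add: A_def scalar_prod_def lessThan_atLeast0 g_def h_def)
  have row_unselected: "(\<Sum>l<q. (s (i l))\<^sup>2 * (g a l)\<^sup>2) + (\<Sum>j<d. \<omega> * (g a (q + j))\<^sup>2)
      \<le> (\<Sum>b<n. (A $$ (a, b))\<^sup>2)" if a: "a < m" "a \<notin> selected" for a
  proof -
    define P where "P b = (\<Sum>l<q. if b = i l then g a l * s (i l) else 0)" for b
    define z where "z = vec d (\<lambda>j. g a (q + j))"
    define Q where "Q b = (if r \<le> b then (C *\<^sub>v z) $ (b - r) else 0)" for b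
    have PQ: "A $$ (a, b) = P b + Q b" if b: "b < n" for b
    proof -
      have "A $$ (a, b) = (\<Sum>j<q + d. g a j * S0 $$ (j, b))"
        unfolding A_entry[OF a(1) b] k[symmetric] using W0_unselected[OF a] by simp
      also have "\<dots> = (\<Sum>j<q. g a j * S0 $$ (j, b)) + (\<Sum>j<d. g a (q + j) * S0 $$ (q + j, b))"
        by (rule sum_lessThan_add)
      also have "(\<Sum>j<q. g a j * S0 $$ (j, b)) = P b"
        unfolding P_def using b by (intro sum.cong) (auto simp: S0_def lk)
      also have "(\<Sum>j<d. g a (q + j) * S0 $$ (q + j, b)) = Q b"
        using b C by (auto simp: Q_def z_def S0_def lk d_def[symmetric] scalar_prod_def lessThan_atLeast0 mult.commute
            intro!: sum.cong)
      finally show ?thesis .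
    qed
    \<comment> \<open>The selected part \<open>P\<close> and the parameter part \<open>Q\<close> of
      a row of \<open>G * S0\<close> have disjoint supports: a selected index from \<open>r\<close>
      on contributes the factor 0 to \<open>P\<close>. So the square of the row splits without a
      cross term.\<close>
    have "P b * Q b = 0" for b
    proof (cases "r \<le> b")
      case True
      then have "P b = 0"
        unfolding P_def using zero i_less by (intro sum.neutral) auto
      then show ?thesis by simp
    qed (simp add: Q_def)
    then have "(P b + Q b)\<^sup>2 = (P b)\<^sup>2 + (Q b)\<^sup>2" for b
      by (simp add: power2_sum)
    then have "(\<Sum>b<n. (A $$ (a, b))\<^sup>2) = (\<Sum>b<n. (P b)\<^sup>2) + (\<Sum>b<n. (Q b)\<^sup>2)"
      by (simp add: PQ sum.distrib)
    moreover have "(\<Sum>b<n. (P b)\<^sup>2) = (\<Sum>l<q. (s (i l))\<^sup>2 * (g a l)\<^sup>2)"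
    proof -
      have "(\<Sum>b<n. (P b)\<^sup>2) = (\<Sum>b\<in>selected. (P b)\<^sup>2)"
        using sel mn by (intro sum.mono_neutral_right) (auto simp: P_def intro!: sum.neutral)
      also have "\<dots> = (\<Sum>l<q. (P (i l))\<^sup>2)" by (simp add: sum.reindex[OF inj])
      also have "P (i l) = g a l * s (i l)" if "l < q" for l
      proof -
        have "P (i l) = (\<Sum>l'<q. if l' = l then g a l * s (i l) else 0)"
          unfolding P_def using that by (intro sum.cong) (auto simp: i_eq)
        then show ?thesis using that by simp
      qed
      then have "(\<Sum>l<q. (P (i l))\<^sup>2) = (\<Sum>l<q. (s (i l))\<^sup>2 * (g a l)\<^sup>2)"
        by (simp add: power_mult_distrib mult.commute)
      finally show ?thesis .
    qed
    moreover have "(\<Sum>j<d. \<omega> * (g a (q + j))\<^sup>2) \<le> (\<Sum>b<n. (Q b)\<^sup>2)"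
    proof (cases "d = 0")
      case False
      have "(\<Sum>j<d. \<omega> * (g a (q + j))\<^sup>2) = \<omega> * (z \<bullet> z)"
        by (simp add: z_def scalar_prod_def lessThan_atLeast0 sum_distrib_left power2_eq_square)
      also have "\<dots> \<le> (C *\<^sub>v z) \<bullet> (C *\<^sub>v z)"
        using False by (intro rayleigh) (auto simp: k z_def)
      also have "\<dots> = (\<Sum>b<n - r. ((C *\<^sub>v z) $ b)\<^sup>2)"
        using C by (simp add: scalar_prod_def[of "C *\<^sub>v z"] lessThan_atLeast0 power2_eq_square)
      also have "\<dots> = (\<Sum>b<n. (Q b)\<^sup>2)"
        unfolding sum_lessThan_shift[symmetric] by (intro sum.cong) (auto simp: Q_def)
      finally show ?thesis .
    qed (simp add: sum_nonneg)
    ultimately show ?thesis by simp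
  qed
  have row_selected: "(\<Sum>b\<in>R. (h l b)\<^sup>2) \<le> (\<Sum>b<n. (A $$ (i l, b))\<^sup>2)" if l: "l < q" for l
  proof -
    have "A $$ (i l, b) = h l b" if b: "b \<in> R" for b
    proof -
      have b': "b < n" "b < r" "b \<notin> selected" using b mn s_pos_iff[of b] by (auto simp: R_def)
      have "A $$ (i l, b) = (\<Sum>j<k. W0 $$ (i l, j) * h j b)"
        unfolding A_entry[OF i_less[OF l] b'(1)] using S0_unselected[OF b'(2,1,3)] by simp
      also have "\<dots> = (\<Sum>j<k. if j = l then h l b else 0)"
        using l by (intro sum.cong) (auto simp: W0_selected)
      also have "\<dots> = h l b" using l qk by simp
      finally show ?thesis .
    qed
    then have "(\<Sum>b\<in>R. (h l b)\<^sup>2) = (\<Sum>b\<in>R. (A $$ (i l, b))\<^sup>2)" by simp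
    also have "\<dots> \<le> (\<Sum>b<n. (A $$ (i l, b))\<^sup>2)"
      using mn by (intro sum_mono2) (auto simp: R_def)
    finally show ?thesis .
  qed
  have finR: "finite R" by (simp add: R_def)
  have "frob_inner A A = (\<Sum>a<m. \<Sum>b<n. (A $$ (a, b))\<^sup>2)"
    by (simp add: frob_inner_sum[OF Ac Ac] power2_eq_square)
  also have "\<dots> \<ge> (\<Sum>a\<in>R \<union> selected. \<Sum>b<n. (A $$ (a, b))\<^sup>2)"
    using sel by (intro sum_mono2) (auto simp: R_def intro: sum_nonneg)
  also have "(\<Sum>a\<in>R \<union> selected. \<Sum>b<n. (A $$ (a, b))\<^sup>2)
      = (\<Sum>a\<in>R. \<Sum>b<n. (A $$ (a, b))\<^sup>2) + (\<Sum>l<q. \<Sum>b<n. (A $$ (i l, b))\<^sup>2)"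
    using finR by (subst sum.union_disjoint) (auto simp: R_def sum.reindex[OF inj])
  finally have AA: "(\<Sum>a\<in>R. (\<Sum>l<q. (s (i l))\<^sup>2 * (g a l)\<^sup>2) + (\<Sum>j<d. \<omega> * (g a (q + j))\<^sup>2))
      + (\<Sum>a\<in>R. \<Sum>l<q. (h l a)\<^sup>2) \<le> frob_inner A A"
  proof (rule order_trans[rotated], intro add_mono)
    show "(\<Sum>a\<in>R. (\<Sum>l<q. (s (i l))\<^sup>2 * (g a l)\<^sup>2) + (\<Sum>j<d. \<omega> * (g a (q + j))\<^sup>2))
      \<le> (\<Sum>a\<in>R. \<Sum>b<n. (A $$ (a, b))\<^sup>2)"
      by (intro sum_mono row_unselected) (auto simp: R_def)
    show "(\<Sum>a\<in>R. \<Sum>l<q. (h l a)\<^sup>2) \<le> (\<Sum>l<q. \<Sum>b<n. (A $$ (i l, b))\<^sup>2)"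
      by (subst sum.swap) (intro sum_mono row_selected, auto)
  qed
  have GHc: "G * H \<in> carrier_mat m n" using G H by simp
  have EGH: "frob_inner E0 (G * H) = (\<Sum>a\<in>R. - (\<Sum>j<k. s a * g a j * h j a))"
  proof -
    have "frob_inner E0 (G * H) = (\<Sum>a<m. \<Sum>b<n. if b = a then (if a \<in> selected then 0
        else - s a) * (\<Sum>j<k. g a j * h j a) else 0)"
      using G H by (subst frob_inner_sum[OF carrier0(4) GHc], intro sum.cong refl)
        (auto simp: E0_def scalar_prod_def lessThan_atLeast0 g_def h_def)
    also have "\<dots> = (\<Sum>a<m. (if a \<in> selected then 0 else - s a) * (\<Sum>j<k. g a j * h j a))"
      using mn by (intro sum.cong) auto
    also have "\<dots> = (\<Sum>a\<in>R. - s a * (\<Sum>j<k. g a j * h j a))"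
    proof (intro sum.mono_neutral_cong_right ballI)
      fix a assume "a \<in> {..<m} - R"
      then have "a \<in> selected \<or> s a = 0" using s_nonneg[of a] by (auto simp: R_def)
      then show "(if a \<in> selected then 0 else - s a) * (\<Sum>j<k. g a j * h j a) = 0" by auto
    qed (auto simp: R_def)
    finally show ?thesis by (simp add: sum_distrib_left mult.assoc sum_negf)
  qed
  have "\<mu> * pair_inner (G, H) (G, H) = \<mu> * ((\<Sum>a<m. \<Sum>j<k. (g a j)\<^sup>2) + (\<Sum>b<n. \<Sum>j<k. (h j b)\<^sup>2))"
    using frob_inner_sum[OF G G] frob_inner_sum[OF H H] sum.swap[of "\<lambda>j b. (h j b)\<^sup>2" "{..<n}" "{..<k}"]
    by (simp add: pair_inner_def frob_inner_def g_def h_def power2_eq_square)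
  \<comment> \<open>Removing squares from the norm increases the product because \<mu> is
    nonpositive.\<close>
  also have "\<dots> \<le> \<mu> * ((\<Sum>a\<in>R. \<Sum>j<k. (g a j)\<^sup>2) + (\<Sum>b\<in>R. \<Sum>j<k. (h j b)\<^sup>2))"
    using \<mu> mn by (intro mult_left_mono_neg add_mono sum_mono2)
      (auto simp: R_def intro: sum_nonneg)
  also have "\<dots> = (\<Sum>a\<in>R. \<Sum>j<q + d. \<mu> * ((g a j)\<^sup>2 + (h j a)\<^sup>2))"
    by (simp add: k sum_distrib_left sum.distrib distrib_left)
  also have "\<dots> = (\<Sum>a\<in>R. (\<Sum>j<q. \<mu> * ((g a j)\<^sup>2 + (h j a)\<^sup>2))
      + (\<Sum>j<d. \<mu> * ((g a (q + j))\<^sup>2 + (h (q + j) a)\<^sup>2)))"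
    by (simp only: sum_lessThan_add)
  also have "\<dots> \<le> (\<Sum>a\<in>R. (\<Sum>j<q. (s (i j))\<^sup>2 * (g a j)\<^sup>2 + (h j a)\<^sup>2 - 2 * s a * g a j * h j a)
      + (\<Sum>j<d. \<omega> * (g a (q + j))\<^sup>2 - 2 * s a * g a (q + j) * h (q + j) a))"
    by (intro sum_mono add_mono form1 form2) (auto simp: R_def k)
  also have "\<dots> = (\<Sum>a\<in>R. (\<Sum>l<q. (s (i l))\<^sup>2 * (g a l)\<^sup>2) + (\<Sum>j<d. \<omega> * (g a (q + j))\<^sup>2))
      + (\<Sum>a\<in>R. \<Sum>l<q. (h l a)\<^sup>2) + 2 * (\<Sum>a\<in>R. - (\<Sum>j<q + d. s a * g a j * h j a))"
    unfolding sum_lessThan_add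
    by (simp add: sum.distrib sum_subtractf sum_distrib_left sum_negf algebra_simps)
  also have "\<dots> \<le> frob_inner A A + 2 * frob_inner E0 (G * H)"
    using AA by (simp add: EGH k)
  also have "\<dots> = pair_inner (G, H) (hessJ X0 W0 S0 (G, H))"
    by (subst hessJ_form[OF _ _ _ G H]) (auto simp: residual0 A_def)
  finally show ?thesis .
qed

text \<open>Pairing an eigenvector with its own image turns the bound on the form into a bound on
  its eigenvalue. Together with \<open>ev\<close> this exhibits \<mu> as the least eigenvalue, so
  the \<open>LEAST\<close> in \<open>hess_lambda_min\<close> is attained.\<close>

lemma hess_lambda_min0:
  assumes ev: "hess_eigenvalue X0 W0 S0 \<mu>" and \<mu>: "\<mu> \<le> 0"
    and form1: "\<And>a l g h. a < m \<Longrightarrow> a \<notin> selected \<Longrightarrow> 0 < s a \<Longrightarrow> l < q \<Longrightarrow>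
      \<mu> * (g\<^sup>2 + h\<^sup>2) \<le> (s (i l))\<^sup>2 * g\<^sup>2 + h\<^sup>2 - 2 * s a * g * h"
    and rayleigh: "\<And>z. q < k \<Longrightarrow> z \<in> carrier_vec (k - q) \<Longrightarrow>
      \<omega> * (z \<bullet> z) \<le> (C *\<^sub>v z) \<bullet> (C *\<^sub>v z)"
    and form2: "\<And>a g h. a < m \<Longrightarrow> a \<notin> selected \<Longrightarrow> 0 < s a \<Longrightarrow> q < k \<Longrightarrow>
      \<mu> * (g\<^sup>2 + h\<^sup>2) \<le> \<omega> * g\<^sup>2 - 2 * s a * g * h"
  shows "hess_lambda_min X0 W0 S0 = \<mu>"
  unfolding hess_lambda_min_def
proof (rule Least_equality[where P = "hess_eigenvalue X0 W0 S0", OF ev])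
  fix \<nu> assume "hess_eigenvalue X0 W0 S0 \<nu>"
  then obtain G H where G: "G \<in> carrier_mat m k" and H: "H \<in> carrier_mat k n"
    and ne: "(G, H) \<noteq> (0\<^sub>m m k, 0\<^sub>m k n)" and e: "hessJ X0 W0 S0 (G, H) = (\<nu> \<cdot>\<^sub>m G, \<nu> \<cdot>\<^sub>m H)"
    unfolding hess_eigenvalue_def by auto
  have "\<mu> * pair_inner (G, H) (G, H) \<le> pair_inner (G, H) (hessJ X0 W0 S0 (G, H))"
    by (rule hess_form0_ge[OF G H \<mu> form1 rayleigh form2])
  also have "\<dots> = \<nu> * pair_inner (G, H) (G, H)"
    using frob_inner_smult_right[OF G G, of \<nu>] frob_inner_smult_right[OF H H, of \<nu>]
    by (simp add: e pair_inner_def frob_inner_def distrib_left)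
  finally have le: "\<mu> * pair_inner (G, H) (G, H) \<le> \<nu> * pair_inner (G, H) (G, H)" .
  have nn: "0 \<le> frob_inner G G" "0 \<le> frob_inner H H"
    using frob_norm_sq[OF G] frob_norm_sq[OF H] by (metis zero_le_power2)+
  have "frob_inner G G \<noteq> 0 \<or> frob_inner H H \<noteq> 0"
  proof (rule ccontr)
    assume "\<not> ?thesis"
    then have "G = 0\<^sub>m m k" "H = 0\<^sub>m k n"
      using frob_inner_self_eq_0 G H by blast+
    with ne show False by simp
  qed
  with nn have "0 < pair_inner (G, H) (G, H)"
    by (auto simp: pair_inner_def frob_inner_def)
  with le show "\<mu> \<le> \<nu>" by simp
qed

end

section \<open>The smallest Hessian eigenvalue in terms of the first deviating position\<close>

context diagonal_point
begin

text \<open>The \<open>j + 1\<close> distinct indices \<open>i 0\<close>, ..., \<open>i j\<close> do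
  not fit below \<open>j\<close>, so one of them is at least \<open>j\<close>. Consequently a
  selection that fails to be maximal fails by a strict inequality downwards.\<close>

lemma selected_le:
  assumes dec: "\<And>j j'. j \<le> j' \<Longrightarrow> j' < q \<Longrightarrow> s (i j') \<le> s (i j)" and j: "j < q"
  shows "s (i j) \<le> s j"
proof -
  have "\<exists>l\<le>j. j \<le> i l"
  proof (rule ccontr)
    assume "\<not> ?thesis"
    then have "i ` {..j} \<subseteq> {..<j}" by (metis image_subsetI atMost_iff lessThan_iff not_le)
    then have "card (i ` {..j}) \<le> card {..<j}" by (intro card_mono) auto
    moreover have "card (i ` {..j}) = card {..j}"
      using j by (intro card_image inj_on_subset[OF inj]) auto
    ultimately show False by simp
  qed
  then obtain l where l: "l \<le> j" "j \<le> i l" by blast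
  have "s (i j) \<le> s (i l)" using dec l j by simp
  also have "\<dots> \<le> s j" using mono[OF l(2)] i_less[of l] l j by simp
  finally show ?thesis .
qed

text \<open>Here \<open>p\<close> counts the initial positions with the leading values. Taking
  \<open>p = q\<close> describes a maximal point and \<open>p < q\<close> one whose first deviation
  is at position \<open>p\<close>; in both cases \<open>s p\<close> is the largest unselected
  value.\<close>

context
  fixes p :: nat
  assumes pm: "p < m" and pq: "p \<le> q" and eq: "\<And>j. j < p \<Longrightarrow> s (i j) = s j"
    and dec: "\<And>j j'. j \<le> j' \<Longrightarrow> j' < q \<Longrightarrow> s (i j') \<le> s (i j)"
    and less: "p < q \<Longrightarrow> s (i p) < s p"
begin

lemma unselected_le_p: "a < m \<Longrightarrow> a \<notin> selected \<Longrightarrow> s a \<le> s p"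
  by (rule unselected_le[where s = s, OF inj sel mono pm pq eq])

lemma unselected_attained_p: obtains a where "a < m" "a \<notin> selected" "s a = s p"
proof (rule unselected_attained[where s = s, OF inj sel mono pm pq eq])
  fix j assume "p \<le> j" "j < q"
  then show "s (i j) < s p" using dec[of p j] less by simp
qed

lemma last_selected:
  assumes "p < q"
  shows "0 \<le> s (i (q - 1))" "s (i (q - 1)) < s p" "l < q \<Longrightarrow> s (i (q - 1)) \<le> s (i l)"
proof -
  have "i (q - 1) < m" "p \<le> q - 1" "q - 1 < q" using assms i_less[of "q - 1"] by auto
  then show "0 \<le> s (i (q - 1))" "s (i (q - 1)) < s p"
    using s_nonneg dec[of p "q - 1"] less assms by auto
  show "s (i (q - 1)) \<le> s (i l)" if "l < q"
    using dec[of l "q - 1"] that by simp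
qed

lemma selected_root_neg_p: "p < q \<Longrightarrow> selected_root (s (i (q - 1))) (s p) < 0"
  using last_selected by (intro selected_root_neg power_strict_mono) auto

lemma selected_eigenvalue:
  assumes "p < q"
  shows "hess_eigenvalue X0 W0 S0 (selected_root (s (i (q - 1))) (s p))"
proof -
  obtain a where a: "a < m" "a \<notin> selected" "s a = s p" by (rule unselected_attained_p)
  show ?thesis
    using a last_selected[OF assms] assms selected_root(1)[of "s (i (q - 1))" "s p"]
    by (intro hess_eigenvalue0_selected[of a "q - 1"]) auto
qed

lemma hess_lambda_min0_full:
  assumes "q = k" "p < q"
  shows "hess_lambda_min X0 W0 S0 = selected_root (s (i (q - 1))) (s p)"
\<comment> \<open>For \<open>q = k\<close> there is no parameter block, so 0 is a dummy value: both
  conditions on \<omega> are vacuous.\<close>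
proof (rule hess_lambda_min0[where \<omega> = 0, OF selected_eigenvalue[OF assms(2)]])
  show "selected_root (s (i (q - 1))) (s p) \<le> 0" using selected_root_neg_p[OF assms(2)] by simp
  show "selected_root (s (i (q - 1))) (s p) * (g\<^sup>2 + h\<^sup>2) \<le> (s (i l))\<^sup>2 * g\<^sup>2 + h\<^sup>2 - 2 * s a * g * h"
    if "a < m" "a \<notin> selected" "0 < s a" "l < q" for a l g h
    using that last_selected(1,2)[OF assms(2)] last_selected(3)[OF assms(2), of l] unselected_le_p[of a] by (intro selected_form_ge) auto
qed (use assms in auto)

context
  fixes \<omega> :: real
  assumes qk_less: "q < k" and \<omega>: "\<omega> = (LEAST \<mu>. eigenvalue (transpose_mat C * C) \<mu>)"
begin

lemma gram:
  "eigenvalue (transpose_mat C * C) \<omega>" "0 \<le> \<omega>"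
  "z \<in> carrier_vec (k - q) \<Longrightarrow> \<omega> * (z \<bullet> z) \<le> (C *\<^sub>v z) \<bullet> (C *\<^sub>v z)"
  using gram_min_eigenvalue[OF C _ \<omega>] qk_less by auto

lemma null_eigenvalue: "hess_eigenvalue X0 W0 S0 (null_root \<omega> (s p))"
proof -
  obtain a where a: "a < m" "a \<notin> selected" "s a = s p" by (rule unselected_attained_p)
  show ?thesis
    using a gram null_root(1)[OF gram(2), of "s p"] by (intro hess_eigenvalue0_null[of a \<omega>]) auto
qed

lemma hess_lambda_min0_maximal:
  assumes "p = q"
  shows "hess_lambda_min X0 W0 S0 = null_root \<omega> (s p)"
proof (rule hess_lambda_min0[OF null_eigenvalue null_root(2)[OF gram(2)]])
  show "null_root \<omega> (s p) * (g\<^sup>2 + h\<^sup>2) \<le> (s (i l))\<^sup>2 * g\<^sup>2 + h\<^sup>2 - 2 * s a * g * h"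
    if a: "a < m" "a \<notin> selected" "0 < s a" "l < q" for a l g h
  proof -
    \<comment> \<open>At a maximal point every selected value dominates every unselected one. The
      selected binary forms are then nonnegative and cannot compete with the null block.\<close>
    have "s a \<le> s p" using unselected_le_p a by blast
    also have "\<dots> \<le> s (i l)" using eq[of l] mono[of l p] pm a assms by simp
    finally have "(s a)\<^sup>2 \<le> (s (i l))\<^sup>2" using a by (intro power_mono) auto
    then have "0 \<le> (s (i l))\<^sup>2 * g\<^sup>2 + h\<^sup>2 - 2 * s a * g * h"
      using binary_form_ge[of 0 "(s (i l))\<^sup>2" 1 "s a" g h] by simp
    moreover have "null_root \<omega> (s p) * (g\<^sup>2 + h\<^sup>2) \<le> 0"
      using null_root(2)[OF gram(2)] by (intro mult_nonpos_nonneg) auto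
    ultimately show ?thesis by linarith
  qed
  show "null_root \<omega> (s p) * (g\<^sup>2 + h\<^sup>2) \<le> \<omega> * g\<^sup>2 - 2 * s a * g * h"
    if "a < m" "a \<notin> selected" "0 < s a" for a g h
    using that unselected_le_p[of a] gram(2) by (intro null_form_ge) auto
qed (use gram(3) in auto)

lemma hess_lambda_min0_not_maximal:
  assumes "p < q"
  shows "hess_lambda_min X0 W0 S0
    = min (null_root \<omega> (s p)) (selected_root (s (i (q - 1))) (s p))" (is "_ = ?\<mu>")
proof (rule hess_lambda_min0)
  show "hess_eigenvalue X0 W0 S0 ?\<mu>"
    using null_eigenvalue selected_eigenvalue[OF assms] by (simp add: min_def)
  show "?\<mu> \<le> 0" using null_root(2)[OF gram(2), of "s p"] by simp
  show "?\<mu> * (g\<^sup>2 + h\<^sup>2) \<le> (s (i l))\<^sup>2 * g\<^sup>2 + h\<^sup>2 - 2 * s a * g * h"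
    if "a < m" "a \<notin> selected" "0 < s a" "l < q" for a l g h
  proof -
    have "?\<mu> * (g\<^sup>2 + h\<^sup>2) \<le> selected_root (s (i (q - 1))) (s p) * (g\<^sup>2 + h\<^sup>2)"
      by (intro mult_right_mono) auto
    also have "\<dots> \<le> (s (i l))\<^sup>2 * g\<^sup>2 + h\<^sup>2 - 2 * s a * g * h"
      using that last_selected(1,2)[OF assms] last_selected(3)[OF assms, of l] unselected_le_p[of a] by (intro selected_form_ge) auto
    finally show ?thesis .
  qed
  show "?\<mu> * (g\<^sup>2 + h\<^sup>2) \<le> \<omega> * g\<^sup>2 - 2 * s a * g * h"
    if "a < m" "a \<notin> selected" "0 < s a" for a g h
  proof -
    have "?\<mu> * (g\<^sup>2 + h\<^sup>2) \<le> null_root \<omega> (s p) * (g\<^sup>2 + h\<^sup>2)"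
      by (intro mult_right_mono) auto
    also have "\<dots> \<le> \<omega> * g\<^sup>2 - 2 * s a * g * h"
      using that unselected_le_p[of a] gram(2) by (intro null_form_ge) auto
    finally show ?thesis .
  qed
qed (use gram(3) in auto)

end

end

end

subsection \<open>The canonical point in the singular bases\<close>

lemma orthonormal_mat_of_cols:
  assumes "orthonormal_basis d b"
  shows "transpose_mat (mat_of_cols d (map b [1..<d + 1])) * mat_of_cols d (map b [1..<d + 1]) = 1\<^sub>m d"
proof (rule eq_matI)
  let ?B = "mat_of_cols d (map b [1..<d + 1])"
  fix i j assume "i < dim_row (1\<^sub>m d :: real mat)" "j < dim_col (1\<^sub>m d :: real mat)"
  then have ij: "i < d" "j < d" by simp_all
  then have c: "col ?B i = b (i + 1)" "col ?B j = b (j + 1)"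
    using assms by (simp_all add: orthonormal_basis_def del: upt_Suc)
  have "(transpose_mat ?B * ?B) $$ (i, j) = b (i + 1) \<bullet> b (j + 1)"
    using ij c by simp
  also have "\<dots> = 1\<^sub>m d $$ (i, j)"
    using assms ij by (auto simp: orthonormal_basis_def)
  finally show "(transpose_mat ?B * ?B) $$ (i, j) = 1\<^sub>m d $$ (i, j)" .
qed simp_all

text \<open>In the case \<open>q < min k m\<close> the strict saddle claim excludes maximal points
  with \<open>r \<le> q\<close>. There \<open>\<sigma> (q + 1) = 0\<close>, and since \<omega> is
  nonnegative the eigenvalue formula gives exactly 0, so the critical point has no negative
  curvature. The formula itself is asserted for all maximal points.\<close>

theorem theorem3p3:
  fixes X C0 W S :: "real mat"
    and \<sigma> lam :: "nat \<Rightarrow> real"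
    and u v :: "nat \<Rightarrow> real vec"
    and \<iota> :: "nat \<Rightarrow> nat"
    and m n k r q p :: nat
    and \<omega> :: real
  assumes "0 < m" and "m < n" and "0 < k"
    and X: "X \<in> carrier_mat m n" and rank: "vec_space.rank m X = r"
    and sv_mono: "\<forall>i \<in> {1..m}. \<forall>j \<in> {1..m}. i \<le> j \<longrightarrow> \<sigma> j \<le> \<sigma> i"
    and sv_pos: "\<forall>i \<in> {1..r}. 0 < \<sigma> i" and sv_zero: "\<forall>i \<in> {r+1..m}. \<sigma> i = 0"
    and svd: "full_svd m n X \<sigma> u v"
    and "1 \<le> q" and "q \<le> min k m"
    and sel: "index_selection m q \<sigma> \<iota> lam"
    and C0: "C0 \<in> carrier_mat (n - r) (k - q)"
    and W: "W = canonical_W m k q u \<iota>"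
    and S: "S = canonical_S n r q v \<iota> lam C0"
    and p: "\<not> maximal_selection q \<sigma> lam \<Longrightarrow> p = (LEAST j. j \<in> {1..q} \<and> lam j < \<sigma> j)"
    and \<omega>: "q < k \<Longrightarrow> \<omega> = (LEAST \<mu>. eigenvalue (transpose_mat C0 * C0) \<mu>)"
  shows
    "(q = m \<or> (q = k \<and> k < m \<and> maximal_selection q \<sigma> lam) \<longrightarrow> global_minimum X W S)
     \<and>
     (q = k \<and> k < m \<and> \<not> maximal_selection q \<sigma> lam \<longrightarrow>
        strict_saddle X W S \<and>
        hess_lambda_min X W S =
          - (((\<sigma> p)\<^sup>2 - (lam k)\<^sup>2) /
             (((lam k)\<^sup>2 + 1) / 2 + sqrt ((\<sigma> p)\<^sup>2 + (((lam k)\<^sup>2 - 1) / 2)\<^sup>2))))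
     \<and>
     (q < min k m \<longrightarrow>
        critical_point X W S \<and>
        (\<not> (maximal_selection q \<sigma> lam \<and> r \<le> q) \<longrightarrow> strict_saddle X W S) \<and>
        (maximal_selection q \<sigma> lam \<longrightarrow>
           hess_lambda_min X W S = \<omega> / 2 - sqrt ((\<sigma> (q + 1))\<^sup>2 + (\<omega> / 2)\<^sup>2)) \<and>
        (\<not> maximal_selection q \<sigma> lam \<longrightarrow>
           hess_lambda_min X W S =
             min (\<omega> / 2 - sqrt ((\<sigma> p)\<^sup>2 + (\<omega> / 2)\<^sup>2))
                 (1 / 2 * ((lam q)\<^sup>2 + 1 - sqrt (((lam q)\<^sup>2 - 1)\<^sup>2 + 4 * (\<sigma> p)\<^sup>2)))))"
proof -
  define s where "s a = \<sigma> (a + 1)" for a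
  define i where "i j = \<iota> (j + 1) - 1" for j
  define U where "U = mat_of_cols m (map u [1..<m + 1])"
  define V where "V = mat_of_cols n (map v [1..<n + 1])"
  have q1: "1 \<le> q" and qk: "q \<le> k" and qm: "q \<le> m" using \<open>1 \<le> q\<close> \<open>q \<le> min k m\<close> by auto
  have \<iota>_inj: "inj_on \<iota> {1..q}" and \<iota>_range: "\<iota> ` {1..q} \<subseteq> {1..m}"
    and lam: "\<forall>j \<in> {1..q}. lam j = \<sigma> (\<iota> j)"
    and lam_dec: "\<forall>j \<in> {1..q}. \<forall>j' \<in> {1..q}. j \<le> j' \<longrightarrow> lam j' \<le> lam j"
    using sel unfolding index_selection_def by iprover+
  have \<iota>: "\<iota> (j + 1) = i j + 1" "i j < m" "j + 1 \<in> {1..q}" if "j < q" for j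
  proof -
    show jq: "j + 1 \<in> {1..q}" using that by simp
    with \<iota>_range have "\<iota> (j + 1) \<in> {1..m}" by blast
    then show "\<iota> (j + 1) = i j + 1" "i j < m" by (auto simp: i_def)
  qed
  have s_i: "s (i j) = lam (j + 1)" if "j < q" for j
    using bspec[OF lam \<iota>(3)[OF that]] \<iota>(1)[OF that] by (simp add: s_def)
  interpret D: diagonal_point m n k q r s i C0
  proof
    show "inj_on i {..<q}"
    proof (rule inj_onI)
      fix j j' assume j: "j \<in> {..<q}" "j' \<in> {..<q}" "i j = i j'"
      then have "\<iota> (j + 1) = \<iota> (j' + 1)" using \<iota>(1) by simp
      then have "j + 1 = j' + 1" using inj_onD[OF \<iota>_inj] \<iota>(3) j by blast
      then show "j = j'" by simp
    qed
    show "s b \<le> s a" if "a \<le> b" "b < m" for a b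
      using sv_mono[rule_format, of "a + 1" "b + 1"] that by (simp add: s_def)
    show "0 < s a" if "a < m" "a < r" for a
      using sv_pos[rule_format, of "a + 1"] that by (simp add: s_def)
    show "s a = 0" if "a < m" "r \<le> a" for a
      using sv_zero[rule_format, of "a + 1"] that by (simp add: s_def)
  qed (use \<open>m < n\<close> qk \<iota>(2) C0 in auto)
  have U: "U \<in> carrier_mat m m" and V: "V \<in> carrier_mat n n"
    by (auto intro!: carrier_matI simp: U_def V_def simp del: upt_Suc)
  have basis: "orthonormal_basis m u" "orthonormal_basis n v"
    and Xv: "\<And>i. i \<in> {1..m} \<Longrightarrow> X *\<^sub>v v i = \<sigma> i \<cdot>\<^sub>v u i"
    and Xv0: "\<And>i. i \<in> {m+1..n} \<Longrightarrow> X *\<^sub>v v i = 0\<^sub>v m"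
    using svd unfolding full_svd_def by auto
  have u: "u (a + 1) \<in> carrier_vec m" if "a < m" for a
    using basis(1) that by (simp add: orthonormal_basis_def)
  have v: "v (b + 1) \<in> carrier_vec n" if "b < n" for b
    using basis(2) that by (simp add: orthonormal_basis_def)
  have U_entry: "U $$ (c, a) = u (a + 1) $ c" if "c < m" "a < m" for c a
    using that by (simp add: U_def mat_of_cols_index del: upt_Suc)
  have V_entry: "V $$ (c, b) = v (b + 1) $ c" if "c < n" "b < n" for c b
    using that by (simp add: V_def mat_of_cols_index del: upt_Suc)
  interpret O: orthogonal_change m n k U V D.X0 D.W0 D.S0
    by unfold_locales
      (use U V orthonormal_mat_of_cols[OF basis(1)] orthonormal_mat_of_cols[OF basis(2)]
        in \<open>simp_all add: U_def V_def del: upt_Suc\<close>)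
  \<comment> \<open>Column by column these are the singular vector equations; the columns from
    \<open>m\<close> on are zero on both sides.\<close>
  have "X * V = U * D.X0"
  proof (rule eq_matI)
    fix a b assume "a < dim_row (U * D.X0)" "b < dim_col (U * D.X0)"
    then have a: "a < m" and b: "b < n" using U by simp_all
    have "col V b = v (b + 1)"
      using b v[OF b] by (simp add: V_def del: upt_Suc)
    then have "(X * V) $$ (a, b) = (X *\<^sub>v v (b + 1)) $ a"
      using a b X V by simp
    also have "\<dots> = (if b < m then s b * u (b + 1) $ a else 0)"
      using Xv[of "b + 1"] Xv0[of "b + 1"] a b u[of b] by (auto simp: s_def)
    also have "\<dots> = (\<Sum>c<m. if c = b then U $$ (a, c) * s c else 0)"
      using a by (simp add: U_entry)
    also have "\<dots> = (\<Sum>c<m. U $$ (a, c) * D.X0 $$ (c, b))"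
      using b by (intro sum.cong) (auto simp: D.X0_def)
    also have "\<dots> = (U * D.X0) $$ (a, b)"
      using a b U by (simp add: scalar_prod_def lessThan_atLeast0)
    finally show "(X * V) $$ (a, b) = (U * D.X0) $$ (a, b)" .
  qed (use X U V in simp_all)
  then have X_eq: "X = U * D.X0 * transpose_mat V"
    using X U V O.VV' by (metis assoc_mult_mat right_mult_one_mat transpose_carrier_mat)
  have W_eq: "W = U * D.W0"
  proof (rule eq_matI)
    fix a j assume "a < dim_row (U * D.W0)" "j < dim_col (U * D.W0)"
    then have a: "a < m" and j: "j < k" using U by simp_all
    have "(U * D.W0) $$ (a, j) = (\<Sum>c<m. U $$ (a, c) * D.W0 $$ (c, j))"
      using a j U by (simp add: scalar_prod_def lessThan_atLeast0)
    also have "\<dots> = (\<Sum>c<m. if c = i j then (if j < q then U $$ (a, c) else 0) else 0)"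
      using j by (intro sum.cong) (auto simp: D.W0_def)
    also have "\<dots> = (if j < q then u (\<iota> (j + 1)) $ a else 0)"
      using a \<iota>[of j] by (simp add: U_entry)
    also have "\<dots> = W $$ (a, j)"
      using a j qk by (auto simp: W canonical_W_def mat_of_cols_index nth_append simp del: upt_Suc)
    finally show "W $$ (a, j) = (U * D.W0) $$ (a, j)" by simp
  qed (use U qk in \<open>simp_all add: W canonical_W_def del: upt_Suc\<close>)
  have "mat_diag q (\<lambda>a. lam (a + 1)) * transpose_mat (mat_of_cols n (map (\<lambda>j. v (\<iota> j)) [1..<q + 1]))
      = mat q n (\<lambda>(a, c). lam (a + 1) * v (\<iota> (a + 1)) $ c)"
    by (subst mat_diag_mult_left[of _ q n])
      (auto intro!: carrier_matI eq_matI simp: mat_of_cols_index simp del: upt_Suc)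
  moreover have "transpose_mat C0 * transpose_mat (mat_of_cols n (map v [r + 1..<n + 1]))
      = mat (k - q) n (\<lambda>(a, c). \<Sum>b<n - r. C0 $$ (b, a) * v (r + b + 1) $ c)"
    using C0 by (intro eq_matI)
      (auto simp: mat_of_cols_index scalar_prod_def lessThan_atLeast0 simp del: upt_Suc)
  ultimately have S': "S = mat q n (\<lambda>(a, c). lam (a + 1) * v (\<iota> (a + 1)) $ c)
      @\<^sub>r mat (k - q) n (\<lambda>(a, c). \<Sum>b<n - r. C0 $$ (b, a) * v (r + b + 1) $ c)"
    by (simp only: S canonical_S_def Let_def)
  have S_eq: "S = D.S0 * transpose_mat V"
  proof (rule eq_matI)
    fix j c assume "j < dim_row (D.S0 * transpose_mat V)" "c < dim_col (D.S0 * transpose_mat V)"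
    then have j: "j < k" and c: "c < n" using V by simp_all
    have SV: "(D.S0 * transpose_mat V) $$ (j, c) = (\<Sum>b<n. D.S0 $$ (j, b) * V $$ (c, b))"
      using j c V by (simp add: scalar_prod_def lessThan_atLeast0)
    show "S $$ (j, c) = (D.S0 * transpose_mat V) $$ (j, c)"
    proof (cases "j < q")
      case True
      have "(D.S0 * transpose_mat V) $$ (j, c) = (\<Sum>b<n. if b = i j then s (i j) * V $$ (c, b) else 0)"
        unfolding SV using True j by (intro sum.cong) (auto simp: D.S0_def)
      also have "\<dots> = lam (j + 1) * v (\<iota> (j + 1)) $ c"
        using c \<iota>[OF True] s_i[OF True] \<open>m < n\<close> by (simp add: V_entry)
      also have "\<dots> = S $$ (j, c)"
        using True c by (simp add: S' append_rows_def)
      finally show ?thesis by simp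
    next
      case False
      have "(D.S0 * transpose_mat V) $$ (j, c)
          = (\<Sum>b<n. if r \<le> b then C0 $$ (b - r, j - q) * v (r + (b - r) + 1) $ c else 0)"
        unfolding SV using False j c by (intro sum.cong) (auto simp: D.S0_def V_entry)
      also have "\<dots> = (\<Sum>b<n - r. C0 $$ (b, j - q) * v (r + b + 1) $ c)"
        by (rule sum_lessThan_shift)
      also have "\<dots> = S $$ (j, c)"
        using False j c by (simp add: S' append_rows_def)
      finally show ?thesis by simp
    qed
  qed (use V qk in \<open>simp_all add: S' append_rows_def\<close>)
  have crit: "critical_point X W S"
    unfolding X_eq W_eq S_eq by (rule O.critical_point_change[OF D.critical_point0])
  have lmin: "hess_lambda_min X W S = hess_lambda_min D.X0 D.W0 D.S0"
    unfolding X_eq W_eq S_eq by (rule O.hess_lambda_min_change)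
  have gmin: "global_minimum D.X0 D.W0 D.S0 \<Longrightarrow> global_minimum X W S"
    unfolding X_eq W_eq S_eq by (rule O.global_minimum_change)
  have dec: "s (i j') \<le> s (i j)" if "j \<le> j'" "j' < q" for j j'
    using lam_dec[rule_format, of "j + 1" "j' + 1"] that by (simp add: s_i)
  have maximal: "maximal_selection q \<sigma> lam \<longleftrightarrow> (\<forall>j<q. s (i j) = s j)"
  proof
    assume "maximal_selection q \<sigma> lam"
    then show "\<forall>j<q. s (i j) = s j"
      unfolding maximal_selection_def using s_i \<iota>(3) by (simp add: s_def)
  next
    assume a: "\<forall>j<q. s (i j) = s j"
    show "maximal_selection q \<sigma> lam"
      unfolding maximal_selection_def
    proof
      fix j assume "j \<in> {1..q}"
      then have "j - 1 < q" "j - 1 + 1 = j" by auto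
      then show "lam j = \<sigma> j" using a[rule_format, of "j - 1"] s_i[of "j - 1"] by (simp add: s_def)
    qed
  qed
  have lam_q: "lam q = s (i (q - 1))" using s_i[of "q - 1"] q1 by simp
  have not_maximal: "\<exists>p0<q. \<sigma> p = s p0 \<and> s (i p0) < s p0 \<and> (\<forall>j<p0. s (i j) = s j)"
    if nm: "\<not> maximal_selection q \<sigma> lam"
  proof -
    define P where "P j \<longleftrightarrow> j \<in> {1..q} \<and> lam j < \<sigma> j" for j
    \<comment> \<open>By \<open>selected_le\<close> a selected value never exceeds the value in its
      place, so being different is the same as being smaller.\<close>
    have P_iff: "P (j + 1) \<longleftrightarrow> j < q \<and> s (i j) \<noteq> s j" for j
      using D.selected_le[OF dec, of j] s_i[of j] by (auto simp: P_def s_def)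
    obtain j where "P (j + 1)" using nm unfolding maximal P_iff by blast
    moreover have pP: "p = (LEAST j. P j)" unfolding P_def by (rule p[OF nm])
    ultimately have Pp: "P p" by (metis LeastI)
    have least: "\<not> P j" if "j < p" for j using that pP not_less_Least by blast
    have "p = (p - 1) + 1" using Pp by (auto simp: P_def)
    then obtain p0 where p0: "p = p0 + 1" by blast
    have "s (i j) = s j" if "j < p0" for j
    proof -
      have "p0 < q" using Pp p0 by (simp add: P_def)
      then show ?thesis using least[of "j + 1"] P_iff[of j] that p0 by simp
    qed
    moreover have "p0 < q" "s (i p0) < s p0" "\<sigma> p = s p0"
      using Pp p0 s_i[of p0] by (auto simp: P_def s_def)
    ultimately show ?thesis by blast
  qed
  show ?thesis
  proof (intro conjI impI)
    assume "q = m \<or> (q = k \<and> k < m \<and> maximal_selection q \<sigma> lam)"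
    then show "global_minimum X W S"
      using D.global_minimum0_full D.global_minimum0_maximal gmin maximal by blast
  next
    assume "q = k \<and> k < m \<and> \<not> maximal_selection q \<sigma> lam"
    then have qk': "q = k" and nm: "\<not> maximal_selection q \<sigma> lam" by auto
    obtain p0 where p0: "p0 < q" "\<sigma> p = s p0" "s (i p0) < s p0" "\<And>j. j < p0 \<Longrightarrow> s (i j) = s j"
      using not_maximal[OF nm] by blast
    have pm: "p0 < m" "p0 \<le> q" using p0(1) qm by auto
    have lam_k: "lam k = s (i (q - 1))" using lam_q qk' by simp
    have e: "hess_lambda_min X W S = selected_root (lam k) (\<sigma> p)"
      unfolding lmin lam_k p0(2)
      by (rule D.hess_lambda_min0_full[OF pm p0(4) dec p0(3) qk' p0(1)])
    show "strict_saddle X W S"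
      unfolding strict_saddle_def e
      using crit D.selected_root_neg_p[OF pm p0(4) dec p0(3) p0(1)] lam_k p0(2) by simp
    show "hess_lambda_min X W S = - (((\<sigma> p)\<^sup>2 - (lam k)\<^sup>2) /
        (((lam k)\<^sup>2 + 1) / 2 + sqrt ((\<sigma> p)\<^sup>2 + (((lam k)\<^sup>2 - 1) / 2)\<^sup>2)))"
      unfolding e by (rule selected_root_alt)
  next
    assume less: "q < min k m"
    then have qk': "q < k" and qm': "q < m" by auto
    note \<omega>' = \<omega>[OF qk']
    show "critical_point X W S" by (rule crit)
    have e1: "hess_lambda_min X W S = null_root \<omega> (\<sigma> (q + 1))" and \<omega>0: "0 \<le> \<omega>"
      if mx: "maximal_selection q \<sigma> lam"
    proof -
      have eq: "s (i j) = s j" if "j < q" for j using mx maximal that by blast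
      show "hess_lambda_min X W S = null_root \<omega> (\<sigma> (q + 1))"
        \<comment> \<open>The position \<open>p\<close> is taken to be \<open>q\<close>, so the
          strict inequality required for \<open>p < q\<close> is vacuous, and \<open>s q\<close> is
          \<open>\<sigma> (q + 1)\<close> in the original indexing.\<close>
        using D.hess_lambda_min0_maximal[OF qm' order.refl eq dec _ qk' \<omega>' refl]
        by (simp add: lmin s_def)
      show "0 \<le> \<omega>" using gram_min_eigenvalue(2)[OF C0 _ \<omega>'] qk' by simp
    qed
    have e2: "hess_lambda_min X W S = min (null_root \<omega> (\<sigma> p)) (selected_root (lam q) (\<sigma> p))"
      and neg: "selected_root (lam q) (\<sigma> p) < 0"
      if nm: "\<not> maximal_selection q \<sigma> lam"
    proof -
      obtain p0 where p0: "p0 < q" "\<sigma> p = s p0" "s (i p0) < s p0" "\<And>j. j < p0 \<Longrightarrow> s (i j) = s j"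
        using not_maximal[OF nm] by blast
      have pm: "p0 < m" "p0 \<le> q" using p0(1) qm by auto
      show "hess_lambda_min X W S = min (null_root \<omega> (\<sigma> p)) (selected_root (lam q) (\<sigma> p))"
        unfolding lmin lam_q p0(2)
        by (rule D.hess_lambda_min0_not_maximal[OF pm p0(4) dec p0(3) qk' \<omega>' p0(1)])
      show "selected_root (lam q) (\<sigma> p) < 0"
        unfolding lam_q p0(2) by (rule D.selected_root_neg_p[OF pm p0(4) dec p0(3) p0(1)])
    qed
    show "hess_lambda_min X W S = \<omega> / 2 - sqrt ((\<sigma> (q + 1))\<^sup>2 + (\<omega> / 2)\<^sup>2)"
      if "maximal_selection q \<sigma> lam"
      using e1[OF that] by (simp add: null_root_def)
    show "hess_lambda_min X W S = min (\<omega> / 2 - sqrt ((\<sigma> p)\<^sup>2 + (\<omega> / 2)\<^sup>2))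
        (1 / 2 * ((lam q)\<^sup>2 + 1 - sqrt (((lam q)\<^sup>2 - 1)\<^sup>2 + 4 * (\<sigma> p)\<^sup>2)))"
      if "\<not> maximal_selection q \<sigma> lam"
      using e2[OF that] by (simp add: null_root_def selected_root_def)
    show "strict_saddle X W S" if ns: "\<not> (maximal_selection q \<sigma> lam \<and> r \<le> q)"
    proof (cases "maximal_selection q \<sigma> lam")
      case True
      then have "0 < \<sigma> (q + 1)" using ns sv_pos by simp
      then show ?thesis
        using crit e1[OF True] null_root(3)[OF \<omega>0[OF True], of "\<sigma> (q + 1)"]
        by (simp add: strict_saddle_def)
    next
      case False
      then show ?thesis
        using crit e2[OF False] neg[OF False] by (simp add: strict_saddle_def)
    qed
  qed
qed

end
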